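(* Let $V^{[*]}$ be a dg vertex algebra, let $C_2^{[*]}(V^{[*]})=\operatorname{Span}\{u_{-2}v\mid u,v\in V^{[*]}\}$ and $R^{[*]}(V^{[*]})=V^{[*]}/C_2^{[*]}(V^{[*]})$, and write $\overline u$ for the class of $u$. Then $R^{[*]}(V^{[*]})$ is a dg Poisson algebra with graded commutative product $\overline u\cdot\overline v=\overline{u_{-1}v}$ and Poisson bracket $\{\overline u,\overline v\}_{R(V)}=\overline{u_0v}$. If $V^{[*]}$ is a dg vertex operator algebra, then $R^{[*]}(V^{[*]})$ is a weight graded dg Poisson algebra $$R^{[*]}(V^{[*]})=\bigoplus_{(p,n)\in\mathbb Z\times\frac12\mathbb Z}R^{[p]}(V^{[*]})_n,$$ where $R^{[p]}(V^{[*]})_n$ is the image of $V^{[p]}_n$ in $R^{[*]}(V^{[*]})$.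
   Context: All vector spaces are over $\mathbb C$. A (cochain) complex $V^{[*]}=\bigoplus_{p\in\mathbb Z}V^{[p]}$ has a differential $d_V$ of degree $+1$ with $d_V^2=0$; $|v|=p$ for $v\in V^{[p]}$. $\operatorname{End}^{[*]}(V^{[*]})=\bigoplus_p\operatorname{End}^{[p]}(V^{[*]})$, where $\operatorname{End}^{[p]}$ is the space of linear maps of degree $p$. A dg vertex algebra $(V^{[*]},d_V,Y(\cdot,x),\mathbf 1)$ is a complex with a linear map $v\mapsto Y(v,x)=\sum_{n\in\mathbb Z}v_nx^{-n-1}\in\operatorname{End}^{[*]}(V^{[*]})[[x,x^{-1}]]$ such that for $v\in V^{[p]}$ one has $v_n\in\operatorname{End}^{[p-2n-2]}(V^{[*]})$ and $(d_Vv)_n=d_V\circ v_n-(-1)^{p}v_n\circ d_V$ (i.e. $Y$ is a chain map, with $|x|=-2$), and a vector $\mathbf 1\in V^{[0]}$ with $d_V\mathbf 1=0$, such that: $u_nv=0$ for $n$ sufficiently large; $Y(\mathbf 1,x)=\operatorname{id}$; $Y(v,x)\mathbf 1\in V^{[*]}[[x]]$ with constant term $v$; and (Jacobi identity) for homogeneous $u,v$ and all $l,m,n\in\mathbb Z$, $$\sum_{i\ge0}(-1)^i\binom li\left(u_{m+l-i}v_{n+i}-(-1)^{l}(-1)^{|u||v|}v_{n+l-i}u_{m+i}\right)=\sum_{i\ge0}\binom mi(u_{l+i}v)_{m+n-i}.$$ A dg vertex operator algebra is a dg vertex algebra with $\omega\in V^{[4]}$, $d_V\omega=0$, such that, writing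 $Y(\omega,x)=\sum_nL(n)x^{-n-2}$: $[L(m),L(n)]=(m-n)L(m+n)+\frac1{12}(m^3-m)\delta_{m+n,0}c_V$ for some $c_V\in\mathbb C$; $L(0)$ is semisimple with $V^{[*]}=\bigoplus_{n\in\frac12\mathbb Z}V_n^{[*]}$, $V_n^{[*]}$ the eigenspace of eigenvalue (weight) $n$, $\omega\in V_2^{[*]}$, $\dim V_n^{[*]}<\infty$, $V_n^{[*]}=0$ for $n\ll0$; and $L(-1)v=v_{-2}\mathbf 1$ for all $v$. Put $V_n^{[p]}=V_n^{[*]}\cap V^{[p]}$. A dg Poisson algebra (with bracket of even degree $k$; here $k=-2$) is an associative dg algebra $(R^{[*]},d)$ with a bilinear bracket $\{-,-\}:R^{[p]}\times R^{[q]}\to R^{[p+q+k]}$ such that for homogeneous $a,b,c$: $\{a,b\}=-(-1)^{|a||b|}\{b,a\}$; $\{a,\{b,c\}\}=\{\{a,b\},c\}+(-1)^{|a||b|}\{b,\{a,c\}\}$; $\{a,bc\}=\{a,b\}c+(-1)^{|a||b|}b\{a,c\}$; $d\{a,b\}=\{da,b\}+(-1)^{|a|}\{a,db\}$. Graded commutative means $ab=(-1)^{|a||b|}ba$. It is weight graded if it has an additional $\frac12\mathbb Z$-grading by subcomplexes (weight) for which the product is additive and the bracket is homogeneous of weight $-1$. *)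

theory Defs
  imports Complex_Main "HOL-Algebra.Algebraic_Closure_Type"
begin

abbreviation complex_field :: "complex ring"
  where "complex_field \<equiv> ring_of_type_algebra"

text \<open>As usual in HOL-Algebra, modules extend the record of rings. The fields \<open>mult\<close> and \<open>one\<close>
  inherited in this way are unconstrained and unused, except for dg algebras below.\<close>

record 'a cochain = "(complex, 'a) module" +
  grade :: "int \<Rightarrow> 'a set"
  differential :: "'a \<Rightarrow> 'a"

definition finsupp_sum :: "('a, 'm) ring_scheme \<Rightarrow> 'i set \<Rightarrow> ('i \<Rightarrow> 'a) \<Rightarrow> 'a"
  where "finsupp_sum M I f = finsum M f {i \<in> I. f i \<noteq> \<zero>\<^bsub>M\<^esub>}"

definition internal_direct_sum ::
    "(complex, 'a, 'm) module_scheme \<Rightarrow> 'i set \<Rightarrow> ('i \<Rightarrow> 'a set) \<Rightarrow> bool"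
  where "internal_direct_sum M I F \<longleftrightarrow>
    (\<forall>i\<in>I. submodule (F i) complex_field M) \<and>
    (\<forall>x\<in>carrier M. \<exists>!f. f \<in> Pi\<^sub>E I F \<and> finite {i \<in> I. f i \<noteq> \<zero>\<^bsub>M\<^esub>} \<and> x = finsupp_sum M I f)"

definition lin_span :: "(complex, 'a, 'm) module_scheme \<Rightarrow> 'a set \<Rightarrow> 'a set"
  where "lin_span M S = \<Inter>{U. submodule U complex_field M \<and> S \<subseteq> U}"

definition linear_op :: "(complex, 'a, 'm) module_scheme \<Rightarrow> ('a \<Rightarrow> 'a) \<Rightarrow> bool"
  where "linear_op M f \<longleftrightarrow>
    f \<in> carrier M \<rightarrow> carrier M \<and>
    (\<forall>x\<in>carrier M. \<forall>y\<in>carrier M. f (x \<oplus>\<^bsub>M\<^esub> y) = f x \<oplus>\<^bsub>M\<^esub> f y) \<and>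
    (\<forall>c. \<forall>x\<in>carrier M. f (c \<odot>\<^bsub>M\<^esub> x) = c \<odot>\<^bsub>M\<^esub> f x)"

locale cochain_complex = module complex_field V
  for V :: "('a, 'm) cochain_scheme" (structure) +
  assumes graded: "internal_direct_sum V UNIV (grade V)"
    and differential_linear: "linear_op V (differential V)"
    and differential_degree: "v \<in> grade V p \<Longrightarrow> differential V v \<in> grade V (p + 1)"
    and differential_square: "v \<in> carrier V \<Longrightarrow> differential V (differential V v) = \<zero>"

definition subcomplex :: "'a set \<Rightarrow> ('a, 'm) cochain_scheme \<Rightarrow> bool"
  where "subcomplex U V \<longleftrightarrow> U \<subseteq> carrier V \<and>
    cochain_complex (V\<lparr>carrier := U, grade := (\<lambda>p. U \<inter> grade V p)\<rparr>)"

abbreviation sgn_pow :: "int \<Rightarrow> complex"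
  where "sgn_pow k \<equiv> (-1) powi k"

text \<open>\<open>nprod V u n v\<close> is \<open>u\<^sub>n v\<close>, where \<open>Y(u,x) = \<Sum> u\<^sub>n x\<^sup>-\<^sup>n\<^sup>-\<^sup>1\<close>.\<close>

record 'a dg_va = "'a cochain" +
  nprod :: "'a \<Rightarrow> int \<Rightarrow> 'a \<Rightarrow> 'a"
  vacuum :: 'a

text \<open>By truncation, the sums in the Jacobi identity have finite support after application to a
  vector \<open>w\<close>, so that they are genuine sums.\<close>

locale dg_vertex_algebra = cochain_complex V
  for V :: "('a, 'm) dg_va_scheme" (structure) +
  assumes Y_linear: "w \<in> carrier V \<Longrightarrow> linear_op V (\<lambda>u. nprod V u n w)"
    and mode_linear: "u \<in> carrier V \<Longrightarrow> linear_op V (nprod V u n)"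
    and mode_degree: "\<lbrakk>u \<in> grade V p; v \<in> grade V q\<rbrakk> \<Longrightarrow> nprod V u n v \<in> grade V (q + (p - 2 * n - 2))"
    and Y_chain_map: "\<lbrakk>u \<in> grade V p; v \<in> carrier V\<rbrakk> \<Longrightarrow>
      nprod V (differential V u) n v =
      differential V (nprod V u n v) \<ominus> sgn_pow p \<odot> nprod V u n (differential V v)"
    and vacuum_degree: "vacuum V \<in> grade V 0"
    and vacuum_closed: "differential V (vacuum V) = \<zero>"
    and truncation: "\<lbrakk>u \<in> carrier V; v \<in> carrier V\<rbrakk> \<Longrightarrow> \<exists>N. \<forall>n\<ge>N. nprod V u n v = \<zero>"
    and vacuum_left: "v \<in> carrier V \<Longrightarrow> nprod V (vacuum V) n v = (if n = -1 then v else \<zero>)"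
    and creation: "\<lbrakk>v \<in> carrier V; n \<ge> 0\<rbrakk> \<Longrightarrow> nprod V v n (vacuum V) = \<zero>"
    and creation_const: "v \<in> carrier V \<Longrightarrow> nprod V v (-1) (vacuum V) = v"
    and jacobi: "\<lbrakk>u \<in> grade V p; v \<in> grade V q; w \<in> carrier V\<rbrakk> \<Longrightarrow>
      finsupp_sum V (UNIV :: nat set) (\<lambda>i. ((-1) ^ i * (of_int l gchoose i)) \<odot>
        (nprod V u (m + l - int i) (nprod V v (n + int i) w)
          \<ominus> (sgn_pow l * sgn_pow (p * q)) \<odot> nprod V v (n + l - int i) (nprod V u (m + int i) w))) =
      finsupp_sum V (UNIV :: nat set) (\<lambda>i. (of_int m gchoose i) \<odot>
        nprod V (nprod V u (l + int i) v) (m + n - int i) w)"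

definition half_integers :: "rat set"
  where "half_integers = {n. 2 * n \<in> \<int>}"

text \<open>The shift comes from \<open>Y(\<omega>,x) = \<Sum> \<omega>\<^sub>n x\<^sup>-\<^sup>n\<^sup>-\<^sup>1 = \<Sum> L(n) x\<^sup>-\<^sup>n\<^sup>-\<^sup>2\<close>.\<close>

definition virasoro :: "('a, 'm) dg_va_scheme \<Rightarrow> 'a \<Rightarrow> int \<Rightarrow> 'a \<Rightarrow> 'a"
  where "virasoro V \<omega> n = nprod V \<omega> (n + 1)"

definition weight_space :: "('a, 'm) dg_va_scheme \<Rightarrow> 'a \<Rightarrow> rat \<Rightarrow> 'a set"
  where "weight_space V \<omega> n = {v \<in> carrier V. virasoro V \<omega> 0 v = of_rat n \<odot>\<^bsub>V\<^esub> v}"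

locale dg_vertex_operator_algebra = dg_vertex_algebra V
  for V :: "('a, 'm) dg_va_scheme" (structure) +
  fixes \<omega> :: 'a
  assumes conformal_degree: "\<omega> \<in> grade V 4"
    and conformal_closed: "differential V \<omega> = \<zero>"
    and virasoro_relations: "\<exists>c. \<forall>m n. \<forall>v\<in>carrier V.
      virasoro V \<omega> m (virasoro V \<omega> n v) \<ominus> virasoro V \<omega> n (virasoro V \<omega> m v) =
      of_int (m - n) \<odot> virasoro V \<omega> (m + n) v
        \<oplus> (1 / 12 * of_int (m ^ 3 - m) * (if m + n = 0 then 1 else 0) * c) \<odot> v"
    and weight_decomposition: "internal_direct_sum V half_integers (weight_space V \<omega>)"
    and conformal_weight: "\<omega> \<in> weight_space V \<omega> 2"
    and weight_space_finite_dim: "n \<in> half_integers \<Longrightarrow>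
      \<exists>B. finite B \<and> B \<subseteq> weight_space V \<omega> n \<and> lin_span V B = weight_space V \<omega> n"
    and weights_bounded_below: "\<exists>N. \<forall>n\<in>half_integers. n < N \<longrightarrow> weight_space V \<omega> n = {\<zero>}"
    and translation: "v \<in> carrier V \<Longrightarrow> virasoro V \<omega> (-1) v = nprod V v (-2) (vacuum V)"

record 'a dg_poisson = "'a cochain" +
  bracket :: "'a \<Rightarrow> 'a \<Rightarrow> 'a"

locale dg_algebra = cochain_complex A + ring A
  for A :: "('a, 'm) cochain_scheme" (structure) +
  assumes smult_mult_left: "\<lbrakk>a \<in> carrier A; b \<in> carrier A\<rbrakk> \<Longrightarrow> (c \<odot> a) \<otimes> b = c \<odot> (a \<otimes> b)"
    and smult_mult_right: "\<lbrakk>a \<in> carrier A; b \<in> carrier A\<rbrakk> \<Longrightarrow> a \<otimes> (c \<odot> b) = c \<odot> (a \<otimes> b)"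
    and one_degree: "\<one> \<in> grade A 0"
    and mult_degree: "\<lbrakk>a \<in> grade A p; b \<in> grade A q\<rbrakk> \<Longrightarrow> a \<otimes> b \<in> grade A (p + q)"
    and leibniz: "\<lbrakk>a \<in> grade A p; b \<in> carrier A\<rbrakk> \<Longrightarrow>
      differential A (a \<otimes> b) = differential A a \<otimes> b \<oplus> sgn_pow p \<odot> (a \<otimes> differential A b)"

definition graded_commutative :: "('a, 'm) cochain_scheme \<Rightarrow> bool"
  where "graded_commutative A \<longleftrightarrow> (\<forall>p q. \<forall>a\<in>grade A p. \<forall>b\<in>grade A q.
    a \<otimes>\<^bsub>A\<^esub> b = sgn_pow (p * q) \<odot>\<^bsub>A\<^esub> (b \<otimes>\<^bsub>A\<^esub> a))"

locale dg_poisson_algebra = dg_algebra A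
  for A :: "('a, 'm) dg_poisson_scheme" (structure) +
  fixes k :: int
  assumes even_degree: "even k"
    and bracket_linear_left: "b \<in> carrier A \<Longrightarrow> linear_op A (\<lambda>a. bracket A a b)"
    and bracket_linear_right: "a \<in> carrier A \<Longrightarrow> linear_op A (bracket A a)"
    and bracket_degree: "\<lbrakk>a \<in> grade A p; b \<in> grade A q\<rbrakk> \<Longrightarrow> bracket A a b \<in> grade A (p + q + k)"
    and bracket_skew: "\<lbrakk>a \<in> grade A p; b \<in> grade A q\<rbrakk> \<Longrightarrow>
      bracket A a b = \<ominus> (sgn_pow (p * q) \<odot> bracket A b a)"
    and bracket_jacobi: "\<lbrakk>a \<in> grade A p; b \<in> grade A q; c \<in> grade A r\<rbrakk> \<Longrightarrow>
      bracket A a (bracket A b c) =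
      bracket A (bracket A a b) c \<oplus> sgn_pow (p * q) \<odot> bracket A b (bracket A a c)"
    and bracket_derivation: "\<lbrakk>a \<in> grade A p; b \<in> grade A q; c \<in> grade A r\<rbrakk> \<Longrightarrow>
      bracket A a (b \<otimes> c) = bracket A a b \<otimes> c \<oplus> sgn_pow (p * q) \<odot> (b \<otimes> bracket A a c)"
    and bracket_chain_map: "\<lbrakk>a \<in> grade A p; b \<in> grade A q\<rbrakk> \<Longrightarrow>
      differential A (bracket A a b) =
      bracket A (differential A a) b \<oplus> sgn_pow p \<odot> bracket A a (differential A b)"

locale weight_graded_dg_poisson_algebra = dg_poisson_algebra A k
  for A :: "('a, 'm) dg_poisson_scheme" (structure) and k +
  fixes W :: "rat \<Rightarrow> 'a set"
  assumes weight_graded: "internal_direct_sum A half_integers W"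
    and weight_subcomplex: "n \<in> half_integers \<Longrightarrow> subcomplex (W n) A"
    and mult_weight: "\<lbrakk>m \<in> half_integers; n \<in> half_integers; a \<in> W m; b \<in> W n\<rbrakk> \<Longrightarrow>
      a \<otimes> b \<in> W (m + n)"
    and bracket_weight: "\<lbrakk>m \<in> half_integers; n \<in> half_integers; a \<in> W m; b \<in> W n\<rbrakk> \<Longrightarrow>
      bracket A a b \<in> W (m + n - 1)"

definition C2 :: "('a, 'm) dg_va_scheme \<Rightarrow> 'a set"
  where "C2 V = lin_span V {nprod V u (-2) v | u v. u \<in> carrier V \<and> v \<in> carrier V}"

definition cls :: "('a, 'm) dg_va_scheme \<Rightarrow> 'a \<Rightarrow> 'a set"
  where "cls V u = C2 V +>\<^bsub>V\<^esub> u"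

text \<open>As for \<^const>\<open>FactRing\<close>, the operations on cosets are defined through all representatives at
  once; where an operation does not depend on representatives, the union is a single coset.\<close>

definition R_alg :: "('a, 'm) dg_va_scheme \<Rightarrow> 'a set dg_poisson"
  where "R_alg V =
    \<lparr>carrier = a_rcosets\<^bsub>V\<^esub> (C2 V),
     monoid.mult = (\<lambda>A B. \<Union>a\<in>A. \<Union>b\<in>B. cls V (nprod V a (-1) b)),
     one = cls V (vacuum V),
     zero = C2 V,
     add = set_add V,
     module.smult = (\<lambda>c A. \<Union>a\<in>A. cls V (c \<odot>\<^bsub>V\<^esub> a)),
     grade = (\<lambda>p. cls V ` grade V p),
     differential = (\<lambda>A. \<Union>a\<in>A. cls V (differential V a)),
     bracket = (\<lambda>A B. \<Union>a\<in>A. \<Union>b\<in>B. cls V (nprod V a 0 b))\<rparr>"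

end

theory Submission
  imports Defs
begin

text \<open>Everything comes from the Jacobi identity read modulo \<open>C\<^sub>2(V)\<close>. Its special cases
  are the commutator formula (\<open>l = 0\<close>) and the associator formula (\<open>m = 0\<close>). The associator
  formula with \<open>v = 1\<close> says that \<open>u\<^sub>-\<^sub>2 1\<close> acts as the derivative of \<open>Y(u,x)\<close>, and
  iterating this puts \<open>u\<^sub>n v\<close> into \<open>C\<^sub>2(V)\<close> for every \<open>n \<le> -2\<close>
  (\<open>nprod_in_C2\<close>). After that, one only has to look at the mode indices in an instance of the
  Jacobi identity: the terms whose outer index is at most \<open>-2\<close> die in the quotient, and what is
  left is an axiom of a Poisson algebra. In this way \<open>C\<^sub>2(V)\<close> absorbs the products
  \<open>n = -1\<close> and \<open>n = 0\<close> from both sides (\<open>C2_absorb_left\<close>, \<open>C2_absorb_right\<close>), the product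
  is commutative and associative (\<open>product_commutative_mod_C2\<close>, \<open>product_associative_mod_C2\<close>) and
  the bracket is skew (\<open>bracket_skew_mod_C2\<close>). The Jacobi identity of the bracket and the derivation
  rule hold before passing to the quotient, since \<open>u\<^sub>0\<close> is a derivation of all products
  (\<open>zero_mode_derivation\<close>).

  For the gradings, the point is that \<open>C\<^sub>2(V)\<close> is spanned by elements \<open>u\<^sub>-\<^sub>2 v\<close> that are
  homogeneous when \<open>u\<close> and \<open>v\<close> are, and such \<open>u\<close> and \<open>v\<close> suffice, so the component projections of \<open>V\<close> preserve it
  (\<open>proj_C2\<close>) and the decomposition of \<open>V\<close> descends to the quotient (\<open>image_direct_sum\<close>). This
  applies to the cohomological degree, to the weight and to the pair of both. The weights add up
  because \<open>[L(0), u\<^sub>k] = (L(0) u)\<^sub>k - (k + 1) u\<^sub>k\<close> (\<open>weight_operator_mode\<close>); the two gradings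
  are compatible because \<open>L(0)\<close> has degree \<open>0\<close>, and \<open>L(0)\<close> commutes with the
  differential because \<open>\<omega>\<close> is closed.\<close>

section \<open>Complex vector spaces\<close>

lemma complex_field_simps [simp]:
  "carrier complex_field = UNIV"
  "a \<oplus>\<^bsub>complex_field\<^esub> b = a + b"
  "a \<otimes>\<^bsub>complex_field\<^esub> b = a * b"
  "\<zero>\<^bsub>complex_field\<^esub> = 0"
  "\<one>\<^bsub>complex_field\<^esub> = 1"
  by (simp_all add: ring_of_type_algebra_def)

lemma complex_field_a_inv [simp]: "\<ominus>\<^bsub>complex_field\<^esub> a = - a"
proof -
  interpret cring complex_field by (rule comm_ring_1_class.cring_from_type_algebra)
  show ?thesis by (rule minus_equality) simp_all
qed

locale complex_space = module complex_field M
  for M :: "(complex, 'a, 'm) module_scheme" (structure)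
begin

lemma smult_add_left: "x \<in> carrier M \<Longrightarrow> (a + b) \<odot> x = a \<odot> x \<oplus> b \<odot> x"
  using smult_l_distr[of a b x] by simp

lemma smult_add_right: "\<lbrakk>x \<in> carrier M; y \<in> carrier M\<rbrakk> \<Longrightarrow> c \<odot> (x \<oplus> y) = c \<odot> x \<oplus> c \<odot> y"
  using smult_r_distr[of c x y] by simp

lemma smult_smult: "x \<in> carrier M \<Longrightarrow> a \<odot> (b \<odot> x) = (a * b) \<odot> x"
  using smult_assoc1[of a b x] by simp

lemma one_smult [simp]: "x \<in> carrier M \<Longrightarrow> 1 \<odot> x = x"
  using smult_one[of x] by simp

lemma zero_smult [simp]: "x \<in> carrier M \<Longrightarrow> 0 \<odot> x = \<zero>"
  using smult_l_null[of x] by simp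

lemma minus_smult: "x \<in> carrier M \<Longrightarrow> (- c) \<odot> x = \<ominus> (c \<odot> x)"
  using smult_l_minus[of c x] by simp

lemma smult_minus: "x \<in> carrier M \<Longrightarrow> c \<odot> (\<ominus> x) = \<ominus> (c \<odot> x)"
  using smult_r_minus[of c x] by simp

lemma minus_eq_iff: "\<lbrakk>x \<in> carrier M; y \<in> carrier M; z \<in> carrier M\<rbrakk> \<Longrightarrow> x \<ominus> y = z \<longleftrightarrow> x = z \<oplus> y"
  by (metis a_minus_def add.inv_solve_right)

lemma minus_eq_zero_iff: "\<lbrakk>x \<in> carrier M; y \<in> carrier M\<rbrakk> \<Longrightarrow> x \<ominus> y = \<zero> \<longleftrightarrow> x = y"
  by (simp add: minus_eq_iff)

lemma submoduleI':
  assumes "U \<subseteq> carrier M" "\<zero> \<in> U" "\<And>x y. \<lbrakk>x \<in> U; y \<in> U\<rbrakk> \<Longrightarrow> x \<oplus> y \<in> U"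
    "\<And>c x. x \<in> U \<Longrightarrow> c \<odot> x \<in> U"
  shows "submodule U complex_field M"
proof (rule submoduleI)
  fix x assume "x \<in> U"
  then have "x \<in> carrier M" "(-1) \<odot> x \<in> U" using assms by auto
  then show "\<ominus> x \<in> U" by (simp add: minus_smult)
qed (use assms in auto)

lemma submoduleD:
  assumes "submodule U complex_field M"
  shows "U \<subseteq> carrier M" "\<And>x. x \<in> U \<Longrightarrow> x \<in> carrier M" "\<zero> \<in> U"
    "\<And>x y. \<lbrakk>x \<in> U; y \<in> U\<rbrakk> \<Longrightarrow> x \<oplus> y \<in> U"
    "\<And>c x. x \<in> U \<Longrightarrow> c \<odot> x \<in> U" "\<And>x. x \<in> U \<Longrightarrow> \<ominus> x \<in> U"
    "\<And>x y. \<lbrakk>x \<in> U; y \<in> U\<rbrakk> \<Longrightarrow> x \<ominus> y \<in> U"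
proof -
  note E = submoduleE[OF assms]
  show sub: "U \<subseteq> carrier M" and "\<And>x. x \<in> U \<Longrightarrow> x \<in> carrier M" using E(1) by auto
  show "\<And>x y. \<lbrakk>x \<in> U; y \<in> U\<rbrakk> \<Longrightarrow> x \<oplus> y \<in> U" "\<And>c x. x \<in> U \<Longrightarrow> c \<odot> x \<in> U"
    "\<And>x. x \<in> U \<Longrightarrow> \<ominus> x \<in> U" using E by auto
  show "\<And>x y. \<lbrakk>x \<in> U; y \<in> U\<rbrakk> \<Longrightarrow> x \<ominus> y \<in> U" using E by (auto simp: a_minus_def)
  obtain x where "x \<in> U" using E(2) by auto
  then show "\<zero> \<in> U" using E(4)[of 0 x] sub by (auto simp: subset_iff)
qed

lemma lin_span_submodule:
  assumes "S \<subseteq> carrier M"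
  shows "submodule (lin_span M S) complex_field M"
  unfolding lin_span_def
proof (rule submoduleI', goal_cases)
  case 1
  then show ?case using carrier_is_submodule assms by auto
qed (auto dest: submoduleD)

lemma lin_span_superset: "S \<subseteq> lin_span M S"
  by (auto simp: lin_span_def)

lemma lin_span_least: "\<lbrakk>submodule U complex_field M; S \<subseteq> U\<rbrakk> \<Longrightarrow> lin_span M S \<subseteq> U"
  by (auto simp: lin_span_def)

lemma linear_opD:
  assumes "linear_op M T"
  shows "\<And>x. x \<in> carrier M \<Longrightarrow> T x \<in> carrier M"
    "\<And>x y. \<lbrakk>x \<in> carrier M; y \<in> carrier M\<rbrakk> \<Longrightarrow> T (x \<oplus> y) = T x \<oplus> T y"
    "\<And>c x. x \<in> carrier M \<Longrightarrow> T (c \<odot> x) = c \<odot> T x"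
    "T \<zero> = \<zero>"
    "\<And>x y. \<lbrakk>x \<in> carrier M; y \<in> carrier M\<rbrakk> \<Longrightarrow> T (x \<ominus> y) = T x \<ominus> T y"
proof -
  show cl: "T x \<in> carrier M" if "x \<in> carrier M" for x
    using assms that unfolding linear_op_def by auto
  show add: "T (x \<oplus> y) = T x \<oplus> T y" if "x \<in> carrier M" "y \<in> carrier M" for x y
    using assms that unfolding linear_op_def by auto
  show sc: "T (c \<odot> x) = c \<odot> T x" if "x \<in> carrier M" for c x
    using assms that unfolding linear_op_def by auto
  show "T \<zero> = \<zero>"
    using sc[of \<zero> 0] cl[of \<zero>] by simp
  show "T (x \<ominus> y) = T x \<ominus> T y" if "x \<in> carrier M" "y \<in> carrier M" for x y
    using add[of x "\<ominus> y"] sc[of y "-1"] cl that by (simp add: a_minus_def minus_smult)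
qed

lemma vimage_submodule:
  assumes "linear_op M T" "submodule U complex_field M"
  shows "submodule {x \<in> carrier M. T x \<in> U} complex_field M"
  by (rule submoduleI') (use linear_opD[OF assms(1)] submoduleD[OF assms(2)] in auto)

lemma linear_op_image_span:
  assumes "linear_op M T" "submodule U complex_field M" "S \<subseteq> carrier M"
    "\<And>x. x \<in> S \<Longrightarrow> T x \<in> U" "x \<in> lin_span M S"
  shows "T x \<in> U"
  using lin_span_least[OF vimage_submodule[OF assms(1,2)], of S] assms(3-5) by auto

lemma linear_op_eq_submodule:
  assumes "linear_op M S" "linear_op M T"
  shows "submodule {x \<in> carrier M. S x = T x} complex_field M"
  by (rule submoduleI') (use linear_opD[OF assms(1)] linear_opD[OF assms(2)] in auto)

lemma linear_op_compose:
  "\<lbrakk>linear_op M S; linear_op M T\<rbrakk> \<Longrightarrow> linear_op M (\<lambda>x. S (T x))"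
  unfolding linear_op_def by (auto simp: Pi_def)

lemma linear_op_smult: "linear_op M T \<Longrightarrow> linear_op M (\<lambda>x. c \<odot> T x)"
  unfolding linear_op_def
  by (auto simp: Pi_def smult_add_right smult_smult mult.commute)

lemma linear_op_add:
  assumes "linear_op M S" "linear_op M T"
  shows "linear_op M (\<lambda>x. S x \<oplus> T x)"
  using linear_opD[OF assms(1)] linear_opD[OF assms(2)]
  unfolding linear_op_def by (auto simp: smult_add_right a_ac)

lemma linear_op_scalar: "linear_op M (\<lambda>x. c \<odot> x)"
  unfolding linear_op_def by (auto simp: smult_add_right smult_smult mult.commute)

lemma linear_op_minus:
  assumes "linear_op M S" "linear_op M T"
  shows "linear_op M (\<lambda>x. S x \<ominus> T x)"
proof -
  have "linear_op M (\<lambda>x. S x \<oplus> (-1) \<odot> T x)"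
    by (intro linear_op_add linear_op_smult assms)
  moreover have "S x \<oplus> (-1) \<odot> T x = S x \<ominus> T x" if "x \<in> carrier M" for x
    using linear_opD(1)[OF assms(2) that] by (simp add: minus_smult a_minus_def)
  ultimately show ?thesis
    using linear_opD(1)[OF assms(1)] linear_opD(1)[OF assms(2)] unfolding linear_op_def by auto
qed

lemma finsupp_sum_eq_finsum:
  assumes "finite A" "A \<subseteq> I" "\<And>i. i \<in> I - A \<Longrightarrow> f i = \<zero>" "\<And>i. i \<in> A \<Longrightarrow> f i \<in> carrier M"
  shows "finsupp_sum M I f = finsum M f A"
  unfolding finsupp_sum_def
  by (rule add.finprod_mono_neutral_cong_left) (use assms in auto)

lemma finsupp_sum_mem:
  assumes U: "submodule U complex_field M" and f: "\<And>i. i \<in> I \<Longrightarrow> f i \<in> U"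
  shows "finsupp_sum M I f \<in> U"
proof (cases "finite {i \<in> I. f i \<noteq> \<zero>}")
  case True
  have "A \<subseteq> I \<Longrightarrow> finsum M f A \<in> U" if "finite A" for A
    using that
  proof induction
    case (insert i A)
    then show ?case using f submoduleD[OF U]
      by (subst finsum_insert) (auto simp: subset_iff)
  qed (use submoduleD[OF U] in simp)
  then show ?thesis using True unfolding finsupp_sum_def by blast
next
  case False
  \<comment> \<open>Sums with infinite support are zero by convention.\<close>
  then show ?thesis using submoduleD[OF U] unfolding finsupp_sum_def by (simp add: finsum_infinite)
qed

lemma finsupp_sum_closed: "(\<And>i. i \<in> I \<Longrightarrow> f i \<in> carrier M) \<Longrightarrow> finsupp_sum M I f \<in> carrier M"
  using finsupp_sum_mem[OF carrier_is_submodule] by blast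

lemma finsupp_sum_single:
  assumes "j \<in> I" "f j \<in> carrier M" "\<And>i. i \<in> I \<Longrightarrow> i \<noteq> j \<Longrightarrow> f i = \<zero>"
  shows "finsupp_sum M I f = f j"
proof -
  have "finsupp_sum M I f = finsum M f {j}"
    by (rule finsupp_sum_eq_finsum) (use assms in auto)
  then show ?thesis using assms by simp
qed

lemma finsupp_sum_zero: "(\<And>i. i \<in> I \<Longrightarrow> f i = \<zero>) \<Longrightarrow> finsupp_sum M I f = \<zero>"
  using finsupp_sum_eq_finsum[of "{}" I f] by simp

lemma finsupp_sum_cong: "(\<And>i. i \<in> I \<Longrightarrow> f i = g i) \<Longrightarrow> (\<And>i. i \<in> I \<Longrightarrow> f i \<in> carrier M) \<Longrightarrow>
    finsupp_sum M I f = finsupp_sum M I g"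
  unfolding finsupp_sum_def by (rule finsum_cong') auto

lemma finsupp_sum_add:
  assumes "finite {i \<in> I. f i \<noteq> \<zero>}" "finite {i \<in> I. g i \<noteq> \<zero>}"
    "\<And>i. i \<in> I \<Longrightarrow> f i \<in> carrier M" "\<And>i. i \<in> I \<Longrightarrow> g i \<in> carrier M"
  shows "finsupp_sum M I (\<lambda>i. f i \<oplus> g i) = finsupp_sum M I f \<oplus> finsupp_sum M I g"
proof -
  let ?A = "{i \<in> I. f i \<noteq> \<zero>} \<union> {i \<in> I. g i \<noteq> \<zero>}"
  have "finsupp_sum M I h = finsum M h ?A"
    if "h = f \<or> h = g \<or> h = (\<lambda>i. f i \<oplus> g i)" for h
    by (rule finsupp_sum_eq_finsum) (use assms that in auto)
  moreover have "finsum M (\<lambda>i. f i \<oplus> g i) ?A = finsum M f ?A \<oplus> finsum M g ?A"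
    by (rule finsum_addf) (use assms in auto)
  ultimately show ?thesis by simp
qed

lemma finsupp_sum_linear:
  assumes T: "linear_op M T" and "finite {i \<in> I. f i \<noteq> \<zero>}" "\<And>i. i \<in> I \<Longrightarrow> f i \<in> carrier M"
  shows "T (finsupp_sum M I f) = finsupp_sum M I (\<lambda>i. T (f i))"
proof -
  let ?A = "{i \<in> I. f i \<noteq> \<zero>}"
  note TD = linear_opD[OF T]
  have "B \<subseteq> I \<Longrightarrow> T (finsum M f B) = finsum M (\<lambda>i. T (f i)) B" if "finite B" for B
    using that
  proof induction
    case (insert i B)
    have "f \<in> B \<rightarrow> carrier M" using insert assms by auto
    then show ?case using insert assms TD
      by (simp add: finsum_insert Pi_def)
  qed (use TD in simp)
  moreover have "finsupp_sum M I (\<lambda>i. T (f i)) = finsum M (\<lambda>i. T (f i)) ?A"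
    by (rule finsupp_sum_eq_finsum) (use assms TD in auto)
  ultimately show ?thesis using assms(2) by (simp add: finsupp_sum_def)
qed

text \<open>This serves for the sums of the Jacobi identity of which a single term survives in a quotient.\<close>

lemma finsupp_sum_mod_submodule:
  assumes U: "submodule U complex_field M" and "finite {i \<in> I. f i \<noteq> \<zero>}" "j \<in> I"
    "\<And>i. i \<in> I \<Longrightarrow> f i \<in> carrier M" "\<And>i. i \<in> I \<Longrightarrow> i \<noteq> j \<Longrightarrow> f i \<in> U"
  shows "finsupp_sum M I f \<ominus> f j \<in> U"
proof -
  let ?g = "\<lambda>i. if i = j then f j else \<zero>" and ?h = "\<lambda>i. if i = j then \<zero> else f i"
  have "finite {i \<in> I. ?g i \<noteq> \<zero>}" "finite {i \<in> I. ?h i \<noteq> \<zero>}"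
    by (rule finite_subset[of _ "{j}"], auto) (rule finite_subset[OF _ assms(2)], auto)
  then have "finsupp_sum M I (\<lambda>i. ?g i \<oplus> ?h i) = finsupp_sum M I ?g \<oplus> finsupp_sum M I ?h"
    by (intro finsupp_sum_add) (use assms in auto)
  moreover have "finsupp_sum M I (\<lambda>i. ?g i \<oplus> ?h i) = finsupp_sum M I f"
    by (rule finsupp_sum_cong) (use assms in auto)
  moreover have "finsupp_sum M I ?g = f j"
    using finsupp_sum_single[of j I ?g] assms by simp
  moreover have h: "finsupp_sum M I ?h \<in> U"
    by (rule finsupp_sum_mem[OF U]) (use assms submoduleD[OF U] in auto)
  moreover have "(f j \<oplus> finsupp_sum M I ?h) \<ominus> f j = finsupp_sum M I ?h"
    using submoduleD(2)[OF U h] assms by (subst minus_eq_iff) (auto simp: a_comm)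
  ultimately show ?thesis by simp
qed

end

lemma (in complex_space) minus_zero [simp]: "\<ominus> \<zero> = \<zero>"
  by (rule minus_equality) simp_all

lemma (in complex_space) submodule_diff_trans:
  assumes "submodule U complex_field M" "x \<ominus> y \<in> U" "y \<ominus> z \<in> U"
    "x \<in> carrier M" "y \<in> carrier M" "z \<in> carrier M"
  shows "x \<ominus> z \<in> U"
proof -
  have "\<ominus> y \<oplus> (y \<ominus> z) = \<ominus> z"
    using assms(5,6) by (simp add: a_minus_def l_neg flip: a_assoc)
  then have "(x \<ominus> y) \<oplus> (y \<ominus> z) = x \<ominus> z"
    using assms(4-6) by (simp add: a_minus_def a_assoc)
  then show ?thesis using submoduleD(4)[OF assms(1-3)] by simp
qed

section \<open>Direct sum decompositions\<close>

definition component :: "(complex, 'a, 'm) module_scheme \<Rightarrow> 'i set \<Rightarrow> ('i \<Rightarrow> 'a set) \<Rightarrow> 'i \<Rightarrow> 'a \<Rightarrow> 'a"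
  where "component M I F i x =
    (THE f. f \<in> Pi\<^sub>E I F \<and> finite {i \<in> I. f i \<noteq> \<zero>\<^bsub>M\<^esub>} \<and> x = finsupp_sum M I f) i"

locale direct_sum = complex_space M for M :: "(complex, 'a, 'm) module_scheme" (structure) +
  fixes I :: "'i set" and F :: "'i \<Rightarrow> 'a set"
  assumes internal_direct_sum: "internal_direct_sum M I F"
begin

abbreviation proj :: "'i \<Rightarrow> 'a \<Rightarrow> 'a"
  where "proj \<equiv> component M I F"

lemma summand_submodule: "i \<in> I \<Longrightarrow> submodule (F i) complex_field M"
  using internal_direct_sum unfolding internal_direct_sum_def by blast

lemma summand_closed: "\<lbrakk>i \<in> I; x \<in> F i\<rbrakk> \<Longrightarrow> x \<in> carrier M"
  using submoduleD(2)[OF summand_submodule] .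

lemma component_family:
  assumes "x \<in> carrier M"
  shows "(\<lambda>i. proj i x) \<in> Pi\<^sub>E I F \<and> finite {i \<in> I. proj i x \<noteq> \<zero>} \<and>
    x = finsupp_sum M I (\<lambda>i. proj i x)"
proof -
  have "\<exists>!f. f \<in> Pi\<^sub>E I F \<and> finite {i \<in> I. f i \<noteq> \<zero>} \<and> x = finsupp_sum M I f"
    using internal_direct_sum assms unfolding internal_direct_sum_def by blast
  from theI'[OF this] show ?thesis unfolding component_def by simp
qed

lemma component_in: "\<lbrakk>x \<in> carrier M; i \<in> I\<rbrakk> \<Longrightarrow> proj i x \<in> F i"
  using component_family by (auto simp: PiE_iff)

lemma component_finite: "x \<in> carrier M \<Longrightarrow> finite {i \<in> I. proj i x \<noteq> \<zero>}"
  using component_family by blast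

lemma component_sum: "x \<in> carrier M \<Longrightarrow> finsupp_sum M I (\<lambda>i. proj i x) = x"
  using component_family by metis

lemma component_unique:
  assumes "\<And>i. i \<in> I \<Longrightarrow> f i \<in> F i" "finite {i \<in> I. f i \<noteq> \<zero>}" "x = finsupp_sum M I f" "i \<in> I"
  shows "proj i x = f i"
proof -
  have f: "\<And>i. i \<in> I \<Longrightarrow> f i \<in> carrier M" using assms(1) summand_closed by blast
  then have x: "x \<in> carrier M" using finsupp_sum_closed assms(3) by auto
  have "{i \<in> I. restrict f I i \<noteq> \<zero>} = {i \<in> I. f i \<noteq> \<zero>}" by auto
  moreover have "finsupp_sum M I f = finsupp_sum M I (restrict f I)"
    by (rule finsupp_sum_cong) (use f in auto)
  ultimately have fam: "restrict f I \<in> Pi\<^sub>E I F \<and> finite {i \<in> I. restrict f I i \<noteq> \<zero>} \<and>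
      x = finsupp_sum M I (restrict f I)"
    using assms by (auto simp: PiE_iff)
  let ?P = "\<lambda>f. f \<in> Pi\<^sub>E I F \<and> finite {i \<in> I. f i \<noteq> \<zero>} \<and> x = finsupp_sum M I f"
  have "\<exists>!f. ?P f"
    using internal_direct_sum x unfolding internal_direct_sum_def by blast
  from the1_equality[where P = ?P, OF this fam] show ?thesis using assms(4) unfolding component_def by simp
qed

lemma component_of_mem:
  assumes "x \<in> F j" "j \<in> I" "i \<in> I"
  shows "proj i x = (if i = j then x else \<zero>)"
proof (rule component_unique[where i = i])
  have x: "x \<in> carrier M" using summand_closed assms(1,2) by blast
  show "x = finsupp_sum M I (\<lambda>i. if i = j then x else \<zero>)"
    using finsupp_sum_single[of j I "\<lambda>i. if i = j then x else \<zero>"] assms(2) x by simp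
  show "finite {i \<in> I. (if i = j then x else \<zero>) \<noteq> \<zero>}"
    by (rule finite_subset[of _ "{j}"]) auto
  show "(if i = j then x else \<zero>) \<in> F i" if "i \<in> I" for i
    using submoduleD(3)[OF summand_submodule[OF that]] assms(1) by simp
qed (rule assms(3))

lemma component_linear:
  assumes i: "i \<in> I"
  shows "linear_op M (proj i)"
  unfolding linear_op_def
proof (intro conjI ballI allI)
  show "proj i \<in> carrier M \<rightarrow> carrier M" using component_in summand_closed i by blast
next
  fix x y assume xy: "x \<in> carrier M" "y \<in> carrier M"
  have cl: "\<And>i. i \<in> I \<Longrightarrow> proj i x \<in> carrier M" "\<And>i. i \<in> I \<Longrightarrow> proj i y \<in> carrier M"
    using component_in summand_closed xy by blast+
  show "proj i (x \<oplus> y) = proj i x \<oplus> proj i y"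
  proof (rule component_unique[OF _ _ _ i])
    show "proj i x \<oplus> proj i y \<in> F i" if "i \<in> I" for i
      using submoduleD(4)[OF summand_submodule[OF that]] component_in that xy by blast
    show "finite {i \<in> I. proj i x \<oplus> proj i y \<noteq> \<zero>}"
      by (rule finite_subset[OF _ finite_UnI[OF component_finite[OF xy(1)] component_finite[OF xy(2)]]])
        auto
    show "x \<oplus> y = finsupp_sum M I (\<lambda>i. proj i x \<oplus> proj i y)"
      using component_sum component_finite xy cl by (subst finsupp_sum_add) auto
  qed
next
  fix c x assume x: "x \<in> carrier M"
  have cl: "\<And>i. i \<in> I \<Longrightarrow> proj i x \<in> carrier M"
    using component_in summand_closed x by blast+
  show "proj i (c \<odot> x) = c \<odot> proj i x"
  proof (rule component_unique[OF _ _ _ i])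
    show "c \<odot> proj i x \<in> F i" if "i \<in> I" for i
      using submoduleD(5)[OF summand_submodule[OF that]] component_in that x by blast
    show "finite {i \<in> I. c \<odot> proj i x \<noteq> \<zero>}"
      by (rule finite_subset[OF _ component_finite[OF x]]) auto
    show "c \<odot> x = finsupp_sum M I (\<lambda>i. c \<odot> proj i x)"
      using finsupp_sum_linear[OF linear_op_scalar component_finite[OF x] cl, of c] component_sum[OF x]
      by simp
  qed
qed

lemma summands_span:
  assumes "submodule U complex_field M" "\<And>i. i \<in> I \<Longrightarrow> F i \<subseteq> U"
  shows "carrier M \<subseteq> U"
proof
  fix x assume x: "x \<in> carrier M"
  have "finsupp_sum M I (\<lambda>i. proj i x) \<in> U"
    by (rule finsupp_sum_mem[OF assms(1)]) (use assms(2) component_in[OF x] in auto)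
  then show "x \<in> U" using component_sum[OF x] by simp
qed

text \<open>Many axioms of a dg vertex algebra are stated for homogeneous arguments; this rule and the next
  extend their consequences to all vectors.\<close>

lemma linear_op_extend:
  assumes "linear_op M T" "submodule U complex_field M" "\<And>i x. \<lbrakk>i \<in> I; x \<in> F i\<rbrakk> \<Longrightarrow> T x \<in> U" "x \<in> carrier M"
  shows "T x \<in> U"
  using summands_span[OF vimage_submodule[OF assms(1,2)]] assms(3,4) summand_closed by blast

lemma linear_op_eqI:
  assumes "linear_op M S" "linear_op M T" "\<And>i x. \<lbrakk>i \<in> I; x \<in> F i\<rbrakk> \<Longrightarrow> S x = T x" "x \<in> carrier M"
  shows "S x = T x"
  using summands_span[OF linear_op_eq_submodule[OF assms(1,2)]] assms(3,4) summand_closed by blast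

lemma component_commute:
  assumes T: "linear_op M T" and pres: "\<And>j x. \<lbrakk>j \<in> I; x \<in> F j\<rbrakk> \<Longrightarrow> T x \<in> F j" and i: "i \<in> I"
    and x: "x \<in> carrier M"
  shows "proj i (T x) = T (proj i x)"
proof (rule linear_op_eqI[of "\<lambda>x. proj i (T x)" "\<lambda>x. T (proj i x)", OF _ _ _ x])
  show "linear_op M (\<lambda>x. proj i (T x))" "linear_op M (\<lambda>x. T (proj i x))"
    using linear_op_compose component_linear[OF i] T by auto
  show "proj i (T x) = T (proj i x)" if "j \<in> I" "x \<in> F j" for j x
    using component_of_mem[OF that(2,1) i] component_of_mem[OF pres[OF that] that(1) i]
      linear_opD(4)[OF T] by simp
qed

end

text \<open>Linear maps that behave on the summands like projections force uniqueness of decompositions,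
  and spanning gives existence: the vectors that are the sum of their finitely many projections form a
  submodule.\<close>

lemma (in complex_space) internal_direct_sumI:
  assumes sub: "\<And>i. i \<in> I \<Longrightarrow> submodule (F i) complex_field M"
    and span: "\<And>U. \<lbrakk>submodule U complex_field M; \<And>i. i \<in> I \<Longrightarrow> F i \<subseteq> U\<rbrakk> \<Longrightarrow> carrier M \<subseteq> U"
    and lin: "\<And>i. i \<in> I \<Longrightarrow> linear_op M (\<pi> i)"
    and proj: "\<And>i j x. \<lbrakk>i \<in> I; j \<in> I; x \<in> F j\<rbrakk> \<Longrightarrow> \<pi> i x = (if i = j then x else \<zero>)"
  shows "internal_direct_sum M I F"
  unfolding internal_direct_sum_def
proof (intro conjI ballI)
  fix x assume x: "x \<in> carrier M"
  let ?U = "{x \<in> carrier M. (\<forall>i\<in>I. \<pi> i x \<in> F i) \<and> finite {i \<in> I. \<pi> i x \<noteq> \<zero>} \<and>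
      finsupp_sum M I (\<lambda>i. \<pi> i x) = x}"
  note subD = submoduleD[OF sub] and linD = linear_opD[OF lin]
  have "submodule ?U complex_field M"
  proof (rule submoduleI')
    have "{i \<in> I. \<pi> i \<zero> \<noteq> \<zero>} = {}" using linD(4) by auto
    then show "\<zero> \<in> ?U" using linD(4) subD(3)
      by (simp add: finsupp_sum_zero del: Collect_empty_eq)
  next
    fix x y assume xy: "x \<in> ?U" "y \<in> ?U"
    have "{i \<in> I. \<pi> i (x \<oplus> y) \<noteq> \<zero>} \<subseteq> {i \<in> I. \<pi> i x \<noteq> \<zero>} \<union> {i \<in> I. \<pi> i y \<noteq> \<zero>}"
      using xy linD by auto
    then have "finite {i \<in> I. \<pi> i (x \<oplus> y) \<noteq> \<zero>}"
      using xy by (auto intro: finite_subset)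
    moreover have "finsupp_sum M I (\<lambda>i. \<pi> i (x \<oplus> y)) = finsupp_sum M I (\<lambda>i. \<pi> i x \<oplus> \<pi> i y)"
      by (rule finsupp_sum_cong) (use xy linD in auto)
    moreover have "\<dots> = x \<oplus> y"
      using xy linD by (subst finsupp_sum_add) auto
    ultimately show "x \<oplus> y \<in> ?U" using xy linD subD by auto
  next
    fix c x assume x: "x \<in> ?U"
    have "finite {i \<in> I. \<pi> i (c \<odot> x) \<noteq> \<zero>}"
      by (rule finite_subset[of _ "{i \<in> I. \<pi> i x \<noteq> \<zero>}"]) (use x linD in auto)
    moreover have "finsupp_sum M I (\<lambda>i. \<pi> i (c \<odot> x)) = finsupp_sum M I (\<lambda>i. c \<odot> \<pi> i x)"
      by (rule finsupp_sum_cong) (use x linD in auto)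
    moreover have "\<dots> = c \<odot> x"
      using x linD finsupp_sum_linear[OF linear_op_scalar, of I "\<lambda>i. \<pi> i x" c] by auto
    ultimately show "c \<odot> x \<in> ?U" using x linD subD by auto
  qed auto
  moreover have "F j \<subseteq> ?U" if "j \<in> I" for j
  proof
    fix x assume x: "x \<in> F j"
    have "finite {i \<in> I. \<pi> i x \<noteq> \<zero>}"
      by (rule finite_subset[of _ "{j}"]) (use x that proj in \<open>auto split: if_splits\<close>)
    moreover have "finsupp_sum M I (\<lambda>i. \<pi> i x) = \<pi> j x"
      by (rule finsupp_sum_single) (use x that proj subD in auto)
    ultimately show "x \<in> ?U" using x that proj subD by auto
  qed
  ultimately have "x \<in> ?U" using span[of ?U] x by blast
  then have ex: "(\<forall>i\<in>I. \<pi> i x \<in> F i)" "finite {i \<in> I. \<pi> i x \<noteq> \<zero>}" "finsupp_sum M I (\<lambda>i. \<pi> i x) = x"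
    by auto
  let ?f = "restrict (\<lambda>i. \<pi> i x) I"
  show "\<exists>!f. f \<in> Pi\<^sub>E I F \<and> finite {i \<in> I. f i \<noteq> \<zero>} \<and> x = finsupp_sum M I f"
  proof (rule ex1I[of _ ?f])
    have "finsupp_sum M I (\<lambda>i. \<pi> i x) = finsupp_sum M I ?f"
      by (rule finsupp_sum_cong) (use ex subD in auto)
    moreover have "{i \<in> I. ?f i \<noteq> \<zero>} = {i \<in> I. \<pi> i x \<noteq> \<zero>}" by auto
    ultimately show "?f \<in> Pi\<^sub>E I F \<and> finite {i \<in> I. ?f i \<noteq> \<zero>} \<and> x = finsupp_sum M I ?f"
      using ex by auto
  next
    fix f assume f: "f \<in> Pi\<^sub>E I F \<and> finite {i \<in> I. f i \<noteq> \<zero>} \<and> x = finsupp_sum M I f"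
    then have fF: "\<And>i. i \<in> I \<Longrightarrow> f i \<in> F i" by (auto simp: PiE_iff)
    have "\<pi> i x = f i" if i: "i \<in> I" for i
    proof -
      have "\<pi> i x = finsupp_sum M I (\<lambda>j. \<pi> i (f j))"
        using f finsupp_sum_linear[OF lin[OF i], of I f] fF subD by auto
      also have "\<dots> = \<pi> i (f i)"
        by (rule finsupp_sum_single) (use i fF proj subD in auto)
      finally show ?thesis using i fF proj by auto
    qed
    then show "f = ?f" using f by (auto simp: PiE_iff fun_eq_iff extensional_def)
  qed
qed (use sub in auto)

text \<open>A direct sum passes to a quotient if the kernel of the quotient map contains the components of
  its elements; then the projections descend.\<close>

lemma (in direct_sum)
  fixes N :: "(complex, 'b, 'n) module_scheme"
  assumes N: "complex_space N" and q: "q ` carrier M = carrier N"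
    and q_add: "\<And>x y. \<lbrakk>x \<in> carrier M; y \<in> carrier M\<rbrakk> \<Longrightarrow> q (x \<oplus> y) = q x \<oplus>\<^bsub>N\<^esub> q y"
    and q_smult: "\<And>c x. x \<in> carrier M \<Longrightarrow> q (c \<odot> x) = c \<odot>\<^bsub>N\<^esub> q x"
    and ker: "\<And>i x. \<lbrakk>i \<in> I; x \<in> carrier M; q x = \<zero>\<^bsub>N\<^esub>\<rbrakk> \<Longrightarrow> q (proj i x) = \<zero>\<^bsub>N\<^esub>"
  shows image_direct_sum: "internal_direct_sum N I (\<lambda>i. q ` F i)"
    and image_component: "\<And>i x. \<lbrakk>i \<in> I; x \<in> carrier M\<rbrakk> \<Longrightarrow>
      component N I (\<lambda>i. q ` F i) i (q x) = q (proj i x)"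
proof -
  interpret N: complex_space N by (rule N)
  have q_closed: "q x \<in> carrier N" if "x \<in> carrier M" for x using q that by blast
  have q_zero: "q \<zero> = \<zero>\<^bsub>N\<^esub>" using q_smult[of \<zero> 0] q_closed[of \<zero>] by simp
  have q_minus: "q (x \<ominus> y) = q x \<ominus>\<^bsub>N\<^esub> q y" if "x \<in> carrier M" "y \<in> carrier M" for x y
    using q_add[of x "\<ominus> y"] q_smult[of y "-1"] q_closed that
    by (simp add: a_minus_def minus_smult N.minus_smult)
  have proj_closed: "proj i x \<in> carrier M" if "i \<in> I" "x \<in> carrier M" for i x
    using component_in summand_closed that by blast
  \<comment> \<open>The projection on \<open>N\<close> is computed on an arbitrary preimage; \<open>ker\<close> makes the choice immaterial.\<close>
  define \<pi> where "\<pi> i z = q (proj i (SOME x. x \<in> carrier M \<and> q x = z))" for i z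
  have \<pi>_q: "\<pi> i (q x) = q (proj i x)" if i: "i \<in> I" and x: "x \<in> carrier M" for i x
  proof -
    define y where "y = (SOME y. y \<in> carrier M \<and> q y = q x)"
    have y: "y \<in> carrier M" "q y = q x"
      using someI[of "\<lambda>y. y \<in> carrier M \<and> q y = q x" x] x unfolding y_def by auto
    have "q (proj i (y \<ominus> x)) = \<zero>\<^bsub>N\<^esub>"
      by (rule ker) (use y x i q_closed in \<open>auto simp: q_minus N.minus_eq_zero_iff\<close>)
    then have "q (proj i y) \<ominus>\<^bsub>N\<^esub> q (proj i x) = \<zero>\<^bsub>N\<^esub>"
      using linear_opD(5)[OF component_linear[OF i] y(1) x] q_minus proj_closed i x y by simp
    then have "q (proj i y) = q (proj i x)"
      using N.minus_eq_zero_iff q_closed proj_closed i x y by simp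
    then show ?thesis unfolding \<pi>_def y_def by simp
  qed
  show direct_sum: "internal_direct_sum N I (\<lambda>i. q ` F i)"
  proof (rule N.internal_direct_sumI)
    fix i assume i: "i \<in> I"
    note D = submoduleD[OF summand_submodule[OF i]]
    show "submodule (q ` F i) complex_field N"
    proof (rule N.submoduleI')
      show "q ` F i \<subseteq> carrier N" using D(2) q_closed by blast
      show "\<zero>\<^bsub>N\<^esub> \<in> q ` F i" using q_zero D(3) by (metis imageI)
      show "a \<oplus>\<^bsub>N\<^esub> b \<in> q ` F i" if "a \<in> q ` F i" "b \<in> q ` F i" for a b
      proof -
        from that obtain x y where "x \<in> F i" "y \<in> F i" "a = q x" "b = q y" by blast
        then show ?thesis using q_add D(2,4) by (metis imageI)
      qed
      show "c \<odot>\<^bsub>N\<^esub> a \<in> q ` F i" if "a \<in> q ` F i" for c a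
      proof -
        from that obtain x where "x \<in> F i" "a = q x" by blast
        then show ?thesis using q_smult D(2,5) by (metis imageI)
      qed
    qed
  next
    fix U assume U: "submodule U complex_field N" "\<And>i. i \<in> I \<Longrightarrow> q ` F i \<subseteq> U"
    have "submodule {x \<in> carrier M. q x \<in> U} complex_field M"
      by (rule submoduleI') (use N.submoduleD[OF U(1)] q_zero q_add q_smult in auto)
    then have "carrier M \<subseteq> {x \<in> carrier M. q x \<in> U}"
      by (rule summands_span) (use U(2) summand_closed in blast)
    then show "carrier N \<subseteq> U" unfolding q[symmetric] by auto
  next
    fix i assume i: "i \<in> I"
    note L = linear_opD[OF component_linear[OF i]]
    show "linear_op N (\<pi> i)"
      unfolding linear_op_def q[symmetric]
    proof (intro conjI Pi_I ballI allI; elim imageE; clarify?)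
      fix x assume "x \<in> carrier M"
      then show "\<pi> i (q x) \<in> q ` carrier M" using \<pi>_q[OF i] L(1) by simp
    next
      fix x y assume xy: "x \<in> carrier M" "y \<in> carrier M"
      show "\<pi> i (q x \<oplus>\<^bsub>N\<^esub> q y) = \<pi> i (q x) \<oplus>\<^bsub>N\<^esub> \<pi> i (q y)"
        using xy L(1,2) \<pi>_q[OF i] by (simp flip: q_add)
    next
      fix c x assume x: "x \<in> carrier M"
      show "\<pi> i (c \<odot>\<^bsub>N\<^esub> q x) = c \<odot>\<^bsub>N\<^esub> \<pi> i (q x)"
        using x L(1,3) \<pi>_q[OF i] by (simp flip: q_smult)
    qed
  next
    fix i j a assume ij: "i \<in> I" "j \<in> I" "a \<in> q ` F j"
    then obtain x where x: "x \<in> F j" "a = q x" by blast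
    then show "\<pi> i a = (if i = j then a else \<zero>\<^bsub>N\<^esub>)"
      using \<pi>_q[OF ij(1) summand_closed[OF ij(2) x(1)]] component_of_mem[OF x(1) ij(2,1)] q_zero by simp
  qed
  then interpret Q: direct_sum N I "\<lambda>i. q ` F i" by unfold_locales
  fix i x assume i: "i \<in> I" and x: "x \<in> carrier M"
  note L = linear_opD[OF component_linear[OF i]] and QL = N.linear_opD[OF Q.component_linear[OF i]]
  let ?U = "{x \<in> carrier M. Q.proj i (q x) = q (proj i x)}"
  have "submodule ?U complex_field M"
    by (rule submoduleI') (use L QL q_zero q_add q_smult q_closed in auto)
  then have "carrier M \<subseteq> ?U"
  proof (rule summands_span)
    show "F j \<subseteq> ?U" if j: "j \<in> I" for j
    proof
      fix x assume x: "x \<in> F j"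
      show "x \<in> ?U"
        using summand_closed[OF j x] component_of_mem[OF x j i] q_zero
          Q.component_of_mem[OF imageI[OF x, of q] j i] by simp
    qed
  qed
  then show "Q.proj i (q x) = q (proj i x)" using x by auto
qed

text \<open>If the projections of one decomposition preserve the summands of another, composing the two
  projections gives the projections of the common refinement.\<close>

lemma (in complex_space) direct_sum_refine:
  assumes F: "direct_sum M I F" and G: "direct_sum M J G"
    and pres: "\<And>i j x. \<lbrakk>i \<in> I; j \<in> J; x \<in> G j\<rbrakk> \<Longrightarrow> component M I F i x \<in> G j"
  shows "internal_direct_sum M (I \<times> J) (\<lambda>(i, j). G j \<inter> F i)"
proof -
  interpret F: direct_sum M I F by (rule F)
  interpret G: direct_sum M J G by (rule G)
  show ?thesis
  proof (rule internal_direct_sumI[where \<pi> = "\<lambda>(i, j) x. F.proj i (G.proj j x)"], goal_cases)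
    case (1 k)
    then obtain i j where k: "k = (i, j)" "i \<in> I" "j \<in> J" by blast
    then show ?case
      using submoduleD[OF F.summand_submodule[OF k(2)]] submoduleD[OF G.summand_submodule[OF k(3)]]
      by (auto intro!: submoduleI')
  next
    case (2 U)
    show ?case
    proof (rule G.summands_span[OF 2(1)], rule subsetI)
      fix j x assume j: "j \<in> J" and x: "x \<in> G j"
      have "finsupp_sum M I (\<lambda>i. F.proj i x) \<in> U"
      proof (rule finsupp_sum_mem[OF 2(1)])
        fix i assume i: "i \<in> I"
        show "F.proj i x \<in> U"
          using 2(2)[of "(i, j)"] i j pres[OF i j x] F.component_in[OF G.summand_closed[OF j x] i] by auto
      qed
      then show "x \<in> U" using F.component_sum[OF G.summand_closed[OF j x]] by simp
    qed
  next
    case (3 k)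
    then show ?case using linear_op_compose F.component_linear G.component_linear by auto
  next
    case (4 k l x)
    then obtain i j i' j' where "k = (i, j)" "l = (i', j')" "i \<in> I" "j \<in> J" "i' \<in> I" "j' \<in> J"
      "x \<in> G j'" "x \<in> F i'" by auto
    then show ?case
      using F.component_of_mem[of x i' i] G.component_of_mem[of x j' j]
        linear_opD(4)[OF F.component_linear[of i]] by (cases "i = i'"; cases "j = j'") simp_all
  qed
qed

lemma (in complex_space) restrict_space:
  fixes N :: "(complex, 'a, 'n) module_scheme"
  assumes U: "submodule (carrier N) complex_field M"
    and N: "zero N = zero M" "add N = add M" "module.smult N = module.smult M"
  shows "complex_space N"
proof -
  note D = submoduleD[OF U]
  have "abelian_group N"
  proof (rule abelian_groupI)
    fix x assume "x \<in> carrier N"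
    then show "\<exists>y\<in>carrier N. y \<oplus>\<^bsub>N\<^esub> x = \<zero>\<^bsub>N\<^esub>"
      using D(2,6) N by (intro bexI[of _ "\<ominus> x"]) (auto simp: l_neg)
  qed (use D N in \<open>auto simp: a_ac\<close>)
  then have "module complex_field N"
    by (rule moduleI[OF R.is_cring])
      (use D N in \<open>auto simp: smult_add_left smult_add_right smult_smult\<close>)
  then show ?thesis by (simp add: complex_space_def)
qed

lemma (in direct_sum) restrict_direct_sum:
  fixes N :: "(complex, 'a, 'n) module_scheme"
  assumes U: "submodule (carrier N) complex_field M"
    and N: "zero N = zero M" "add N = add M" "module.smult N = module.smult M"
    and proj: "\<And>i x. \<lbrakk>i \<in> I; x \<in> carrier N\<rbrakk> \<Longrightarrow> proj i x \<in> carrier N"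
  shows "internal_direct_sum N I (\<lambda>i. carrier N \<inter> F i)"
proof -
  interpret N: complex_space N by (rule restrict_space[OF U N])
  note D = submoduleD[OF U]
  show ?thesis
  proof (rule N.internal_direct_sumI[where \<pi> = proj])
    fix i assume i: "i \<in> I"
    show "submodule (carrier N \<inter> F i) complex_field N"
      using submoduleD[OF summand_submodule[OF i]] D N by (auto intro!: N.submoduleI')
    show "linear_op N (proj i)"
      using linear_opD[OF component_linear[OF i]] proj[OF i] D(2) N unfolding linear_op_def by auto
  next
    fix W assume W: "submodule W complex_field N" "\<And>i. i \<in> I \<Longrightarrow> carrier N \<inter> F i \<subseteq> W"
    have W': "submodule W complex_field M"
      using N.submoduleD[OF W(1)] D N by (intro submoduleI') auto
    show "carrier N \<subseteq> W"
    proof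
      fix x assume x: "x \<in> carrier N"
      then have xM: "x \<in> carrier M" using D(2) by blast
      have "finsupp_sum M I (\<lambda>i. proj i x) \<in> W"
        by (rule finsupp_sum_mem[OF W']) (use W(2) proj x component_in[OF xM] in blast)
      then show "x \<in> W" using component_sum[OF xM] by simp
    qed
  next
    fix i j x assume "i \<in> I" "j \<in> I" "x \<in> carrier N \<inter> F j"
    then show "proj i x = (if i = j then x else \<zero>\<^bsub>N\<^esub>)"
      using component_of_mem[of x j i] by (simp add: N)
  qed
qed

sublocale cochain_complex \<subseteq> complex_space V
  by (simp add: complex_space_def module_axioms)

sublocale cochain_complex \<subseteq> grading: direct_sum V UNIV "grade V"
  by unfold_locales (rule graded)

section \<open>Consequences of the Jacobi identity\<close>

context cochain_complex
begin

lemma grade_closed: "x \<in> grade V p \<Longrightarrow> x \<in> carrier V"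
  using grading.summand_closed by blast

lemma differential_closed [simp]: "x \<in> carrier V \<Longrightarrow> differential V x \<in> carrier V"
  using linear_opD(1)[OF differential_linear] .

end

context dg_vertex_algebra
begin

lemma nprod_closed [simp]: "\<lbrakk>u \<in> carrier V; v \<in> carrier V\<rbrakk> \<Longrightarrow> nprod V u n v \<in> carrier V"
  using linear_opD(1)[OF mode_linear] .

lemma nprod_zero_right [simp]: "u \<in> carrier V \<Longrightarrow> nprod V u n \<zero> = \<zero>"
  using linear_opD(4)[OF mode_linear] .

lemma nprod_zero_left [simp]: "v \<in> carrier V \<Longrightarrow> nprod V \<zero> n v = \<zero>"
  using linear_opD(4)[OF Y_linear] .

lemma vacuum_closed [simp]: "vacuum V \<in> carrier V"
  using vacuum_degree grade_closed by blast

lemma linear_modes: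
  assumes "linear_op V T" "v \<in> carrier V"
  shows "linear_op V (\<lambda>u. nprod V v n (T u))" "linear_op V (\<lambda>u. nprod V (T u) n v)"
  using linear_op_compose[OF mode_linear[OF assms(2)] assms(1)]
    linear_op_compose[OF Y_linear[OF assms(2)] assms(1)] by auto

text \<open>The case \<open>l = 0\<close> of the Jacobi identity.\<close>

lemma commutator_formula:
  assumes u: "u \<in> grade V p" and v: "v \<in> grade V q" and w: "w \<in> carrier V"
  shows "nprod V u m (nprod V v n w) \<ominus> sgn_pow (p * q) \<odot> nprod V v n (nprod V u m w) =
    finsupp_sum V (UNIV :: nat set) (\<lambda>i. (of_int m gchoose i) \<odot>
        nprod V (nprod V u (int i) v) (m + n - int i) w)"
proof -
  note cl = grade_closed[OF u] grade_closed[OF v] w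
  let ?f = "\<lambda>i. ((-1) ^ i * (of_int 0 gchoose i)) \<odot>
        (nprod V u (m + 0 - int i) (nprod V v (n + int i) w)
          \<ominus> (sgn_pow 0 * sgn_pow (p * q)) \<odot> nprod V v (n + 0 - int i) (nprod V u (m + int i) w))"
  have "finsupp_sum V (UNIV :: nat set) ?f = ?f 0"
  proof (rule finsupp_sum_single)
    fix i :: nat assume "i \<noteq> 0"
    then have "(0 :: complex) gchoose i = 0" by (cases i) auto
    then show "?f i = \<zero>" using cl by simp
  qed (use cl in auto)
  then show ?thesis using jacobi[OF u v w, of 0 m n] cl by simp
qed

lemma commutator_zero_mode:
  assumes u: "u \<in> grade V p" and v: "v \<in> grade V q" and w: "w \<in> carrier V"
  shows "nprod V u 0 (nprod V v n w) \<ominus> sgn_pow (p * q) \<odot> nprod V v n (nprod V u 0 w) =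
    nprod V (nprod V u 0 v) n w"
proof -
  note cl = grade_closed[OF u] grade_closed[OF v] w
  let ?f = "\<lambda>i. (of_int 0 gchoose i) \<odot> nprod V (nprod V u (int i) v) (0 + n - int i) w"
  have "finsupp_sum V (UNIV :: nat set) ?f = ?f 0"
  proof (rule finsupp_sum_single)
    fix i :: nat assume "i \<noteq> 0"
    then have "(0 :: complex) gchoose i = 0" by (cases i) auto
    then show "?f i = \<zero>" using cl by simp
  qed (use cl in auto)
  then show ?thesis using commutator_formula[OF u v w, of 0 n] cl by simp
qed

text \<open>Hence \<open>u\<^sub>0\<close> is a derivation of every \<open>n\<close>-th product: for \<open>n = 0\<close> this is the Jacobi identity
  of the bracket, for \<open>n = -1\<close> the Leibniz rule between bracket and product.\<close>

lemma zero_mode_derivation: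
  assumes u: "u \<in> grade V p" and v: "v \<in> grade V q" and w: "w \<in> carrier V"
  shows "nprod V u 0 (nprod V v n w) =
    nprod V (nprod V u 0 v) n w \<oplus> sgn_pow (p * q) \<odot> nprod V v n (nprod V u 0 w)"
  using commutator_zero_mode[OF u v w, of n] grade_closed[OF u] grade_closed[OF v] w
  by (subst (asm) minus_eq_iff) auto

text \<open>The case \<open>m = 0\<close> of the Jacobi identity.\<close>

lemma associator_formula:
  assumes u: "u \<in> grade V p" and v: "v \<in> grade V q" and w: "w \<in> carrier V"
  shows "nprod V (nprod V u l v) n w =
    finsupp_sum V (UNIV :: nat set) (\<lambda>i. ((-1) ^ i * (of_int l gchoose i)) \<odot>
        (nprod V u (l - int i) (nprod V v (n + int i) w)
          \<ominus> (sgn_pow l * sgn_pow (p * q)) \<odot> nprod V v (n + l - int i) (nprod V u (int i) w)))"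
proof -
  note cl = grade_closed[OF u] grade_closed[OF v] w
  let ?f = "\<lambda>i. (of_int 0 gchoose i) \<odot> nprod V (nprod V u (l + int i) v) (0 + n - int i) w"
  have "finsupp_sum V (UNIV :: nat set) ?f = ?f 0"
  proof (rule finsupp_sum_single)
    fix i :: nat assume "i \<noteq> 0"
    then have "(0 :: complex) gchoose i = 0" by (cases i) auto
    then show "?f i = \<zero>" using cl by simp
  qed (use cl in auto)
  then show ?thesis using jacobi[OF u v w, of l 0 n] cl by simp
qed

lemma associator_support_finite:
  assumes "u \<in> carrier V" "v \<in> carrier V" "w \<in> carrier V"
  shows "finite {i \<in> UNIV :: nat set. c i \<odot> (nprod V u (l - int i) (nprod V v (n + int i) w)
    \<ominus> b \<odot> nprod V v (n + l - int i) (nprod V u (int i) w)) \<noteq> \<zero>}"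
proof -
  obtain N1 where N1: "\<And>n. n \<ge> N1 \<Longrightarrow> nprod V v n w = \<zero>" using truncation assms by blast
  obtain N2 where N2: "\<And>n. n \<ge> N2 \<Longrightarrow> nprod V u n w = \<zero>" using truncation assms by blast
  show ?thesis
  proof (rule finite_subset[of _ "{..nat (N1 - n)} \<union> {..nat N2}"], rule subsetI, rule ccontr)
    fix i
    assume i: "i \<in> {i \<in> UNIV. c i \<odot> (nprod V u (l - int i) (nprod V v (n + int i) w)
      \<ominus> b \<odot> nprod V v (n + l - int i) (nprod V u (int i) w)) \<noteq> \<zero>}"
    assume "i \<notin> {..nat (N1 - n)} \<union> {..nat N2}"
    then have "n + int i \<ge> N1" "int i \<ge> N2" by auto
    then show False using i N1 N2 assms by (simp add: a_minus_def)
  qed auto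
qed

lemma gbinomial_minus_two: "(-1) ^ i * ((-2 :: complex) gchoose i) = of_nat (Suc i)"
proof -
  have "(-2 :: complex) gchoose i = (-1) ^ i * (2 + of_nat i - 1 gchoose i)"
    by (rule gbinomial_minus)
  also have "(2 + of_nat i - 1 gchoose i) = (of_nat (Suc i) gchoose i :: complex)"
    by (simp add: algebra_simps)
  also have "\<dots> = of_nat (Suc i)"
    by (simp only: binomial_gbinomial[symmetric] binomial_Suc_n)
  finally show ?thesis by (simp flip: power_add mult.assoc add: mult_2[symmetric])
qed

text \<open>This is \<open>Y(u\<^sub>-\<^sub>2 1, x) = d/dx Y(u, x)\<close>. In the associator formula for \<open>u\<^sub>-\<^sub>2 1\<close>, a
  mode of the vacuum is nonzero only at index \<open>-1\<close>, so at most one summand survives: one with \<open>u\<close>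
  on the left if \<open>n < 0\<close>, one with \<open>u\<close> on the right if \<open>n > 0\<close>.\<close>

lemma translate_mode:
  assumes u: "u \<in> carrier V" and w: "w \<in> carrier V"
  shows "nprod V (nprod V u (-2) (vacuum V)) n w = of_int (- n) \<odot> nprod V u (n - 1) w"
proof (rule grading.linear_op_eqI[OF _ _ _ u])
  show "linear_op V (\<lambda>u. nprod V (nprod V u (-2) (vacuum V)) n w)"
    by (rule linear_modes[OF Y_linear[OF vacuum_closed] w])
  show "linear_op V (\<lambda>u. of_int (- n) \<odot> nprod V u (n - 1) w)"
    by (rule linear_op_smult[OF Y_linear[OF w]])
next
  fix p u assume u: "u \<in> grade V p"
  note cl = grade_closed[OF u] w
  let ?f = "\<lambda>i. ((-1) ^ i * (of_int (-2) gchoose i)) \<odot>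
        (nprod V u (-2 - int i) (nprod V (vacuum V) (n + int i) w)
          \<ominus> (sgn_pow (-2) * sgn_pow (p * 0)) \<odot> nprod V (vacuum V) (n + -2 - int i) (nprod V u (int i) w))"
  have eq: "nprod V (nprod V u (-2) (vacuum V)) n w = finsupp_sum V UNIV ?f"
    using associator_formula[OF u vacuum_degree w, of "-2" n] .
  have f: "?f i = of_nat (Suc i) \<odot>
        ((if n + int i = -1 then nprod V u (-2 - int i) w else \<zero>)
          \<ominus> (if n - int i = 1 then nprod V u (int i) w else \<zero>))" for i
  proof -
    have "(n + -2 - int i = -1) = (n - int i = 1)" by auto
    then show ?thesis using cl gbinomial_minus_two[of i] by (simp add: vacuum_left)
  qed
  consider "n < 0" | "n = 0" | "n > 0" by linarith
  then show "nprod V (nprod V u (-2) (vacuum V)) n w = of_int (- n) \<odot> nprod V u (n - 1) w"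
  proof cases
    case 1
    define j where "j = nat (-1 - n)"
    have j: "n = -1 - int j" using 1 by (simp add: j_def)
    have sum: "finsupp_sum V UNIV ?f = ?f j"
    proof (rule finsupp_sum_single)
      show "?f i = \<zero>" if "i \<noteq> j" for i
        unfolding f using that j by (auto simp: a_minus_def)
    qed (use cl in auto)
    have "nprod V u (-2 - int j) w = nprod V u (n - 1) w" unfolding j by simp
    moreover have "(of_nat (Suc j) :: complex) = of_int (- n)" "n + int j = -1" "n - int j \<noteq> 1"
      using j by simp_all
    ultimately show ?thesis unfolding eq unfolding sum unfolding f
      using cl by (simp add: a_minus_def del: of_nat_Suc)
  next
    case 2
    have "finsupp_sum V UNIV ?f = \<zero>"
      by (rule finsupp_sum_zero, unfold f) (use 2 in \<open>auto simp: a_minus_def\<close>)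
    then show ?thesis unfolding eq using 2 cl by simp
  next
    case 3
    define j where "j = nat (n - 1)"
    have j: "n = 1 + int j" using 3 by (simp add: j_def)
    have sum: "finsupp_sum V UNIV ?f = ?f j"
    proof (rule finsupp_sum_single)
      show "?f i = \<zero>" if "i \<noteq> j" for i
        unfolding f using that j by (auto simp: a_minus_def)
    qed (use cl in auto)
    show ?thesis unfolding eq unfolding sum unfolding f
      using j cl minus_smult[of "nprod V u (int j) w" "1 + of_nat j"]
      by (simp add: a_minus_def smult_minus)
  qed
qed

section \<open>The subspace \<open>C\<^sub>2(V)\<close>\<close>

lemma C2_generators_closed:
  "{nprod V u (-2) v | u v. u \<in> carrier V \<and> v \<in> carrier V} \<subseteq> carrier V"
  by auto

lemma C2_submodule: "submodule (C2 V) complex_field V"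
  unfolding C2_def by (rule lin_span_submodule[OF C2_generators_closed])

lemma nprod_minus_two_in_C2: "\<lbrakk>u \<in> carrier V; v \<in> carrier V\<rbrakk> \<Longrightarrow> nprod V u (-2) v \<in> C2 V"
  unfolding C2_def by (rule subsetD[OF lin_span_superset]) auto

text \<open>By induction: \<open>u\<^sub>n\<^sub>-\<^sub>1 v\<close> is a nonzero multiple of \<open>(u\<^sub>-\<^sub>2 1)\<^sub>n v\<close> if \<open>n \<le> -2\<close>.\<close>

lemma nprod_in_C2:
  assumes "u \<in> carrier V" "v \<in> carrier V" "n \<le> -2"
  shows "nprod V u n v \<in> C2 V"
proof -
  have "nprod V u (-2 - int k) v \<in> C2 V" for k
    using assms(1)
  proof (induction k arbitrary: u)
    case 0
    then show ?case using nprod_minus_two_in_C2 assms by simp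
  next
    case (Suc k)
    let ?n = "-2 - int k"
    have "of_int (- ?n) \<odot> nprod V u (?n - 1) v \<in> C2 V"
      using Suc.IH[of "nprod V u (-2) (vacuum V)"] translate_mode[of u v ?n] Suc.prems assms by simp
    then have "(1 / of_int (- ?n)) \<odot> (of_int (- ?n) \<odot> nprod V u (?n - 1) v) \<in> C2 V"
      using submoduleD(5)[OF C2_submodule] by blast
    moreover have "(of_int (- ?n) :: complex) \<noteq> 0" by (subst of_int_eq_0_iff) simp
    ultimately have "nprod V u (?n - 1) v \<in> C2 V"
      using Suc.prems assms by (simp only: smult_smult nprod_closed) simp
    moreover have "?n - 1 = -2 - int (Suc k)" by simp
    ultimately show ?case by metis
  qed
  from this[of "nat (-2 - n)"] show ?thesis using assms by simp
qed

text \<open>\<open>C\<^sub>2(V)\<close> is already spanned by the \<open>u\<^sub>-\<^sub>2 v\<close> with \<open>u\<close> and \<open>v\<close> homogeneous, for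
  whatever decomposition of \<open>V\<close>; hence linear maps need to be tested on these only.\<close>

lemma C2_image:
  assumes I: "direct_sum V I F" and T: "linear_op V T" and U: "submodule U complex_field V"
    and gen: "\<And>i j u v. \<lbrakk>i \<in> I; j \<in> I; u \<in> F i; v \<in> F j\<rbrakk> \<Longrightarrow> T (nprod V u (-2) v) \<in> U"
    and x: "x \<in> C2 V"
  shows "T x \<in> U"
proof -
  interpret I: direct_sum V I F by (rule I)
  have "T (nprod V u (-2) v) \<in> U" if u: "u \<in> carrier V" and v: "v \<in> carrier V" for u v
  proof (rule I.linear_op_extend[of "\<lambda>u. T (nprod V u (-2) v)", OF _ U _ u])
    show "linear_op V (\<lambda>u. T (nprod V u (-2) v))"
      by (rule linear_op_compose[OF T Y_linear[OF v]])
    fix i u assume i: "i \<in> I" "u \<in> F i"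
    show "T (nprod V u (-2) v) \<in> U"
    proof (rule I.linear_op_extend[of "\<lambda>v. T (nprod V u (-2) v)", OF _ U _ v])
      show "linear_op V (\<lambda>v. T (nprod V u (-2) v))"
        by (rule linear_op_compose[OF T mode_linear[OF I.summand_closed[OF i]]])
    qed (rule gen[OF i(1) _ i(2)])
  qed
  then show ?thesis
    by (intro linear_op_image_span[OF T U C2_generators_closed _ x[unfolded C2_def]]) auto
qed

text \<open>A homogeneous generator is either fixed or killed by each projection.\<close>

lemma proj_C2:
  assumes I: "direct_sum V I F"
    and gen: "\<And>i j u v. \<lbrakk>i \<in> I; j \<in> I; u \<in> F i; v \<in> F j\<rbrakk> \<Longrightarrow> \<exists>k\<in>I. nprod V u (-2) v \<in> F k"
    and i: "i \<in> I" and x: "x \<in> C2 V"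
  shows "component V I F i x \<in> C2 V"
proof -
  interpret I: direct_sum V I F by (rule I)
  show ?thesis
  proof (rule C2_image[OF I I.component_linear[OF i] C2_submodule _ x])
    fix j k u v assume jk: "j \<in> I" "k \<in> I" "u \<in> F j" "v \<in> F k"
    then obtain r where r: "r \<in> I" "nprod V u (-2) v \<in> F r" using gen by blast
    show "I.proj i (nprod V u (-2) v) \<in> C2 V"
      unfolding I.component_of_mem[OF r(2,1) i]
      using nprod_minus_two_in_C2 I.summand_closed jk submoduleD(3)[OF C2_submodule] by simp
  qed
qed

lemma grading_proj_C2: "x \<in> C2 V \<Longrightarrow> grading.proj p x \<in> C2 V"
  by (rule proj_C2[OF grading.direct_sum_axioms]) (auto intro: mode_degree)

text \<open>In \<open>a\<^sub>m u\<^sub>-\<^sub>2 v = \<plusminus> u\<^sub>-\<^sub>2 a\<^sub>m v + \<Sum>\<^sub>i (m choose i) (a\<^sub>i u)\<^sub>m\<^sub>-\<^sub>2\<^sub>-\<^sub>i v\<close> all outer indices are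
  at most \<open>-2\<close>.\<close>

lemma C2_absorb_right:
  assumes a: "a \<in> carrier V" and x: "x \<in> C2 V" and m: "m \<le> 0"
  shows "nprod V a m x \<in> C2 V"
proof -
  have xV: "x \<in> carrier V" using submoduleD(2)[OF C2_submodule x] .
  show ?thesis
  proof (rule grading.linear_op_extend[OF Y_linear[OF xV] C2_submodule _ a])
    fix p a assume a: "a \<in> grade V p"
    show "nprod V a m x \<in> C2 V"
    proof (rule C2_image[OF grading.direct_sum_axioms mode_linear[OF grade_closed[OF a]] C2_submodule _ x])
      fix q r u v assume u: "u \<in> grade V q" and v: "v \<in> grade V r"
      note cl = grade_closed[OF a] grade_closed[OF u] grade_closed[OF v]
      let ?c = "sgn_pow (p * q) \<odot> nprod V u (-2) (nprod V a m v)"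
      let ?S = "finsupp_sum V (UNIV :: nat set) (\<lambda>i. (of_int m gchoose i) \<odot>
        nprod V (nprod V a (int i) u) (m + -2 - int i) v)"
      have S: "?S \<in> C2 V"
        by (intro finsupp_sum_mem[OF C2_submodule] submoduleD(5)[OF C2_submodule] nprod_in_C2)
          (use cl m in auto)
      have "nprod V a m (nprod V u (-2) v) \<ominus> ?c = ?S"
        by (rule commutator_formula[OF a u cl(3)])
      then have "nprod V a m (nprod V u (-2) v) = ?S \<oplus> ?c"
        using cl submoduleD(2)[OF C2_submodule S] by (subst (asm) minus_eq_iff) auto
      moreover have "?c \<in> C2 V"
        by (intro submoduleD(5)[OF C2_submodule] nprod_in_C2) (use cl in auto)
      ultimately show "nprod V a m (nprod V u (-2) v) \<in> C2 V"
        using S submoduleD(4)[OF C2_submodule] by simp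
    qed
  qed
qed

text \<open>The associator formula expands \<open>(u\<^sub>-\<^sub>2 v)\<^sub>n a\<close> into terms with outer modes
  \<open>u\<^sub>-\<^sub>2\<^sub>-\<^sub>i\<close> and \<open>v\<^sub>n\<^sub>-\<^sub>2\<^sub>-\<^sub>i\<close>.\<close>

lemma C2_absorb_left:
  assumes a: "a \<in> carrier V" and x: "x \<in> C2 V" and n: "n \<le> 0"
  shows "nprod V x n a \<in> C2 V"
proof (rule C2_image[OF grading.direct_sum_axioms Y_linear[OF a] C2_submodule _ x])
  fix p q u v assume u: "u \<in> grade V p" and v: "v \<in> grade V q"
  note cl = grade_closed[OF u] grade_closed[OF v] a
  show "nprod V (nprod V u (-2) v) n a \<in> C2 V"
    unfolding associator_formula[OF u v a]
    by (intro finsupp_sum_mem[OF C2_submodule] submoduleD(5,7)[OF C2_submodule] nprod_in_C2)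
      (use cl n in auto)
qed

text \<open>The commutator of \<open>u\<^sub>-\<^sub>1\<close> and \<open>v\<^sub>-\<^sub>1\<close>, applied to the vacuum, involves outer modes of index
  \<open>-2 - i\<close> only.\<close>

lemma product_commutative_mod_C2:
  assumes u: "u \<in> grade V p" and v: "v \<in> grade V q"
  shows "nprod V u (-1) v \<ominus> sgn_pow (p * q) \<odot> nprod V v (-1) u \<in> C2 V"
proof -
  note cl = grade_closed[OF u] grade_closed[OF v]
  have "finsupp_sum V (UNIV :: nat set) (\<lambda>i. (of_int (-1) gchoose i) \<odot>
      nprod V (nprod V u (int i) v) (-1 + -1 - int i) (vacuum V)) \<in> C2 V"
    by (intro finsupp_sum_mem[OF C2_submodule] submoduleD(5)[OF C2_submodule] nprod_in_C2)
      (use cl in auto)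
  then show ?thesis
    unfolding commutator_formula[OF u v vacuum_closed, symmetric] using cl by (simp add: creation_const)
qed

text \<open>The choice \<open>l = 1\<close>, \<open>m = n = -1\<close> in the Jacobi identity, applied to the vacuum: by creation
  only \<open>i = 0\<close> contributes on the left, where it gives \<open>u\<^sub>0 v\<^sub>-\<^sub>1 1\<close> and \<open>v\<^sub>0 u\<^sub>-\<^sub>1 1\<close>, while the
  outer indices on the right are \<open>-2 - i\<close>.\<close>

lemma bracket_skew_mod_C2:
  assumes u: "u \<in> grade V p" and v: "v \<in> grade V q"
  shows "nprod V u 0 v \<oplus> sgn_pow (p * q) \<odot> nprod V v 0 u \<in> C2 V"
proof -
  note cl = grade_closed[OF u] grade_closed[OF v]
  let ?f = "\<lambda>i. ((-1) ^ i * (of_int 1 gchoose i)) \<odot>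
        (nprod V u (-1 + 1 - int i) (nprod V v (-1 + int i) (vacuum V))
          \<ominus> (sgn_pow 1 * sgn_pow (p * q)) \<odot> nprod V v (-1 + 1 - int i) (nprod V u (-1 + int i) (vacuum V)))"
  have "finsupp_sum V (UNIV :: nat set) ?f = ?f 0"
    by (rule finsupp_sum_single) (use cl in \<open>auto simp: creation a_minus_def\<close>)
  moreover have "?f 0 = nprod V u 0 v \<oplus> sgn_pow (p * q) \<odot> nprod V v 0 u"
    using cl by (simp add: creation_const a_minus_def minus_smult)
  moreover have "finsupp_sum V (UNIV :: nat set) (\<lambda>i. (of_int (-1) gchoose i) \<odot>
      nprod V (nprod V u (1 + int i) v) (-1 + -1 - int i) (vacuum V)) \<in> C2 V"
    by (intro finsupp_sum_mem[OF C2_submodule] submoduleD(5)[OF C2_submodule] nprod_in_C2)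
      (use cl in auto)
  ultimately show ?thesis using jacobi[OF u v vacuum_closed, of 1 "-1" "-1"] by simp
qed

text \<open>The associator formula with \<open>l = n = -1\<close> has the leading term \<open>u\<^sub>-\<^sub>1 v\<^sub>-\<^sub>1 w\<close>; its other
  outer modes are \<open>u\<^sub>-\<^sub>1\<^sub>-\<^sub>i\<close> with \<open>i > 0\<close> and \<open>v\<^sub>-\<^sub>2\<^sub>-\<^sub>i\<close> with \<open>i \<ge> 0\<close>.\<close>

lemma product_associative_mod_C2:
  assumes u: "u \<in> carrier V" and v: "v \<in> carrier V" and w: "w \<in> carrier V"
  shows "nprod V (nprod V u (-1) v) (-1) w \<ominus> nprod V u (-1) (nprod V v (-1) w) \<in> C2 V"
proof -
  let ?A = "\<lambda>u v. nprod V (nprod V u (-1) v) (-1) w \<ominus> nprod V u (-1) (nprod V v (-1) w)"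
  have hom: "?A u v \<in> C2 V" if u: "u \<in> grade V p" and v: "v \<in> grade V q" for u v p q
  proof -
    note cl = grade_closed[OF u] grade_closed[OF v] w
    let ?f = "\<lambda>i. ((-1) ^ i * (of_int (-1) gchoose i)) \<odot>
        (nprod V u (-1 - int i) (nprod V v (-1 + int i) w)
          \<ominus> (sgn_pow (-1) * sgn_pow (p * q)) \<odot> nprod V v (-1 + -1 - int i) (nprod V u (int i) w))"
    have "finsupp_sum V (UNIV :: nat set) ?f \<ominus> ?f 0 \<in> C2 V"
    proof (rule finsupp_sum_mod_submodule[OF C2_submodule])
      show "?f i \<in> C2 V" if "i \<noteq> 0" for i
        by (intro submoduleD(5,7)[OF C2_submodule] nprod_in_C2) (use cl that in auto)
      show "finite {i \<in> UNIV. ?f i \<noteq> \<zero>}" by (rule associator_support_finite[OF cl])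
    qed (use cl in auto)
    moreover have "?f 0 \<ominus> nprod V u (-1) (nprod V v (-1) w) \<in> C2 V"
    proof -
      let ?x = "nprod V u (-1) (nprod V v (-1) w)"
      let ?y = "(sgn_pow (-1) * sgn_pow (p * q)) \<odot> nprod V v (-2) (nprod V u 0 w)"
      have y: "?y \<in> C2 V"
        by (intro submoduleD(5)[OF C2_submodule] nprod_in_C2) (use cl in auto)
      have "?f 0 = ?x \<ominus> ?y" using cl by simp
      moreover have "(?x \<ominus> ?y) \<ominus> ?x = \<ominus> ?y"
        using cl by (subst minus_eq_iff) (auto simp: a_minus_def a_ac)
      ultimately show ?thesis using submoduleD(6)[OF C2_submodule y] by simp
    qed
    ultimately show ?thesis
      unfolding associator_formula[OF u v w]
      by (rule submodule_diff_trans[OF C2_submodule]) (use cl in \<open>auto intro!: finsupp_sum_closed\<close>)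
  qed
  show ?thesis
  proof (rule grading.linear_op_extend[of "\<lambda>u. ?A u v", OF _ C2_submodule _ u])
    show "linear_op V (\<lambda>u. ?A u v)"
      by (intro linear_op_minus linear_modes Y_linear nprod_closed v w)
    fix p u assume u: "u \<in> grade V p"
    show "?A u v \<in> C2 V"
    proof (rule grading.linear_op_extend[of "?A u", OF _ C2_submodule _ v])
      show "linear_op V (?A u)"
        by (intro linear_op_minus linear_modes Y_linear mode_linear grade_closed[OF u] w)
    qed (rule hom[OF u])
  qed
qed

lemma differential_nprod:
  assumes u: "u \<in> grade V p" and v: "v \<in> carrier V"
  shows "differential V (nprod V u n v) =
    nprod V (differential V u) n v \<oplus> sgn_pow p \<odot> nprod V u n (differential V v)"
  using Y_chain_map[OF u v, of n, symmetric] grade_closed[OF u] v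
  by (subst (asm) minus_eq_iff) auto

lemma differential_C2: "x \<in> C2 V \<Longrightarrow> differential V x \<in> C2 V"
proof (rule C2_image[OF grading.direct_sum_axioms differential_linear C2_submodule])
  fix p q u v assume u: "u \<in> grade V p" and v: "v \<in> grade V q"
  note cl = grade_closed[OF u] grade_closed[OF v]
  show "differential V (nprod V u (-2) v) \<in> C2 V"
    unfolding differential_nprod[OF u cl(2)]
    by (intro submoduleD(4,5)[OF C2_submodule] nprod_in_C2) (use cl in auto)
qed

end

section \<open>The Poisson algebra \<open>R(V)\<close>\<close>

context dg_vertex_algebra
begin

lemma C2_abelian_subgroup: "abelian_subgroup (C2 V) V"
  by (intro abelian_subgroupI3 additive_subgroup.intro submodule.axioms(1)[OF C2_submodule]
      abelian_group_axioms)

lemma cls_self: "u \<in> carrier V \<Longrightarrow> u \<in> cls V u"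
  unfolding cls_def by (rule abelian_subgroup.a_rcos_self[OF C2_abelian_subgroup])

lemma mem_cls_iff: "\<lbrakk>u \<in> carrier V; v \<in> carrier V\<rbrakk> \<Longrightarrow> v \<in> cls V u \<longleftrightarrow> v \<ominus> u \<in> C2 V"
  unfolding cls_def a_minus_def by (rule abelian_subgroup.a_rcos_module[OF C2_abelian_subgroup])

lemma cls_eqI: "\<lbrakk>v \<in> cls V u; u \<in> carrier V\<rbrakk> \<Longrightarrow> cls V v = cls V u"
  unfolding cls_def using abelian_subgroup.a_repr_independence'[OF C2_abelian_subgroup] by metis

lemma cls_eq_iff:
  assumes "u \<in> carrier V" "v \<in> carrier V"
  shows "cls V u = cls V v \<longleftrightarrow> u \<ominus> v \<in> C2 V"
  using cls_eqI[of u v] cls_self[OF assms(1)] mem_cls_iff[OF assms(2,1)] assms by metis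

lemma cls_subset_carrier: "\<lbrakk>v \<in> cls V u; u \<in> carrier V\<rbrakk> \<Longrightarrow> v \<in> carrier V"
  unfolding cls_def using abelian_subgroup.a_elemrcos_carrier[OF C2_abelian_subgroup] by metis

text \<open>The operations of \<^const>\<open>R_alg\<close> are unions over representatives, which collapse to one coset
  for maps that are constant on classes.\<close>

lemma Union_cls:
  assumes "u \<in> carrier V" "\<And>a. \<lbrakk>a \<in> carrier V; cls V a = cls V u\<rbrakk> \<Longrightarrow> g a = g u"
  shows "(\<Union>a\<in>cls V u. g a) = g u"
proof -
  have "g a = g u" if "a \<in> cls V u" for a
    using assms(2) cls_subset_carrier[OF that assms(1)] cls_eqI[OF that assms(1)] by blast
  then show ?thesis using cls_self[OF assms(1)] by blast
qed

lemma cls_linear: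
  assumes T: "linear_op V T" and C2: "\<And>x. x \<in> C2 V \<Longrightarrow> T x \<in> C2 V"
    and "u \<in> carrier V" "v \<in> carrier V" "cls V u = cls V v"
  shows "cls V (T u) = cls V (T v)"
  using assms(3-5) C2[of "u \<ominus> v"] linear_opD(5)[OF T, of u v] linear_opD(1)[OF T]
  by (simp add: cls_eq_iff)

text \<open>Both absorption properties of \<open>C\<^sub>2(V)\<close> together make the products well defined on classes.\<close>

lemma cls_nprod:
  assumes n: "n \<le> 0" and u: "u \<in> carrier V" "u' \<in> carrier V" "cls V u = cls V u'"
    and v: "v \<in> carrier V" "v' \<in> carrier V" "cls V v = cls V v'"
  shows "cls V (nprod V u n v) = cls V (nprod V u' n v')"
proof -
  have "cls V (nprod V u n v) = cls V (nprod V u' n v)"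
    by (rule cls_linear[OF Y_linear[OF v(1)] C2_absorb_left[OF v(1) _ n] u])
  also have "\<dots> = cls V (nprod V u' n v')"
    by (rule cls_linear[OF mode_linear[OF u(2)] C2_absorb_right[OF u(2) _ n] v])
  finally show ?thesis .
qed

abbreviation A where "A \<equiv> R_alg V"

lemma carrier_A: "carrier A = cls V ` carrier V"
  by (auto simp: R_alg_def A_RCOSETS_def' cls_def)

lemma cls_closed [simp]: "u \<in> carrier V \<Longrightarrow> cls V u \<in> carrier A"
  by (simp add: carrier_A)

lemma zero_A: "\<zero>\<^bsub>A\<^esub> = cls V \<zero>"
  using submoduleD(1)[OF C2_submodule] by (simp add: R_alg_def cls_def)

lemma one_A: "\<one>\<^bsub>A\<^esub> = cls V (vacuum V)"
  by (simp add: R_alg_def)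

lemma add_A: "\<lbrakk>u \<in> carrier V; v \<in> carrier V\<rbrakk> \<Longrightarrow> cls V u \<oplus>\<^bsub>A\<^esub> cls V v = cls V (u \<oplus> v)"
  unfolding cls_def R_alg_def
  by (simp add: abelian_subgroup.a_rcos_sum[OF C2_abelian_subgroup])

lemma smult_A:
  assumes u: "u \<in> carrier V"
  shows "c \<odot>\<^bsub>A\<^esub> cls V u = cls V (c \<odot> u)"
proof -
  have "(\<Union>a\<in>cls V u. cls V (c \<odot> a)) = cls V (c \<odot> u)"
    by (rule Union_cls[OF u], rule cls_linear[OF linear_op_scalar submoduleD(5)[OF C2_submodule] _ u])
  then show ?thesis by (simp add: R_alg_def)
qed

lemma Union_cls2:
  assumes n: "n \<le> 0" and uv: "u \<in> carrier V" "v \<in> carrier V"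
  shows "(\<Union>a\<in>cls V u. \<Union>b\<in>cls V v. cls V (nprod V a n b)) = cls V (nprod V u n v)"
proof -
  have "(\<Union>b\<in>cls V v. cls V (nprod V a n b)) = cls V (nprod V a n v)" if "a \<in> carrier V" for a
    by (rule Union_cls[OF uv(2)]) (rule cls_nprod[OF n that that refl _ uv(2)])
  then have "(\<Union>a\<in>cls V u. \<Union>b\<in>cls V v. cls V (nprod V a n b)) = (\<Union>a\<in>cls V u. cls V (nprod V a n v))"
    using cls_subset_carrier uv by simp
  also have "\<dots> = cls V (nprod V u n v)"
    by (rule Union_cls[OF uv(1)]) (rule cls_nprod[OF n _ uv(1) _ uv(2,2) refl])
  finally show ?thesis .
qed

lemma mult_A: "\<lbrakk>u \<in> carrier V; v \<in> carrier V\<rbrakk> \<Longrightarrow> cls V u \<otimes>\<^bsub>A\<^esub> cls V v = cls V (nprod V u (-1) v)"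
  using Union_cls2[of "-1" u v] by (simp add: R_alg_def)

lemma bracket_A: "\<lbrakk>u \<in> carrier V; v \<in> carrier V\<rbrakk> \<Longrightarrow> bracket A (cls V u) (cls V v) = cls V (nprod V u 0 v)"
  using Union_cls2[of 0 u v] by (simp add: R_alg_def)

lemma differential_A:
  assumes u: "u \<in> carrier V"
  shows "differential A (cls V u) = cls V (differential V u)"
proof -
  have "(\<Union>a\<in>cls V u. cls V (differential V a)) = cls V (differential V u)"
    by (rule Union_cls[OF u], rule cls_linear[OF differential_linear differential_C2 _ u])
  then show ?thesis by (simp add: R_alg_def)
qed

lemma grade_A: "grade A p = cls V ` grade V p"
  by (simp add: R_alg_def)

lemmas A_ops = zero_A one_A add_A smult_A mult_A bracket_A differential_A

lemma cls_eq_zero_iff: "u \<in> carrier V \<Longrightarrow> cls V u = \<zero>\<^bsub>A\<^esub> \<longleftrightarrow> u \<in> C2 V"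
  unfolding zero_A by (simp add: cls_eq_iff a_minus_def)

lemma A_complex_space: "complex_space A"
proof -
  have "abelian_group A"
  proof (rule abelian_groupI)
    fix x assume "x \<in> carrier A"
    then obtain u where "u \<in> carrier V" "x = cls V u" unfolding carrier_A by blast
    then show "\<exists>y\<in>carrier A. y \<oplus>\<^bsub>A\<^esub> x = \<zero>\<^bsub>A\<^esub>"
      by (intro bexI[of _ "cls V (\<ominus> u)"]) (simp_all add: A_ops l_neg)
  qed (auto simp: carrier_A A_ops a_ac)
  then have "module complex_field A"
    by (rule moduleI[OF R.is_cring])
      (auto simp: carrier_A A_ops smult_add_left smult_add_right smult_smult)
  then show ?thesis by (simp add: complex_space_def)
qed

lemma image_direct_sum_A:
  assumes I: "direct_sum V I F"
    and ker: "\<And>i x. \<lbrakk>i \<in> I; x \<in> C2 V\<rbrakk> \<Longrightarrow> component V I F i x \<in> C2 V"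
  shows "internal_direct_sum A I (\<lambda>i. cls V ` F i)"
    and "\<lbrakk>i \<in> I; x \<in> carrier V\<rbrakk> \<Longrightarrow> component A I (\<lambda>i. cls V ` F i) i (cls V x) = cls V (component V I F i x)"
proof -
  interpret I: direct_sum V I F by (rule I)
  have ker': "cls V (I.proj i x) = \<zero>\<^bsub>A\<^esub>" if "i \<in> I" "x \<in> carrier V" "cls V x = \<zero>\<^bsub>A\<^esub>" for i x
    using that ker[OF that(1)] linear_opD(1)[OF I.component_linear[OF that(1)] that(2)]
    by (simp add: cls_eq_zero_iff)
  note facts = A_complex_space carrier_A[symmetric] add_A[symmetric] smult_A[symmetric] ker'
  show "internal_direct_sum A I (\<lambda>i. cls V ` F i)"
    by (rule I.image_direct_sum[OF facts])
  show "component A I (\<lambda>i. cls V ` F i) i (cls V x) = cls V (I.proj i x)" if "i \<in> I" "x \<in> carrier V"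
    by (rule I.image_component[OF facts that])
qed

lemma A_cochain_complex: "cochain_complex A"
proof -
  interpret A: complex_space A by (rule A_complex_space)
  note D = linear_opD[OF differential_linear]
  have "grade A = (\<lambda>p. cls V ` grade V p)" by (rule ext) (rule grade_A)
  then have gr: "internal_direct_sum A UNIV (grade A)"
    using image_direct_sum_A(1)[OF grading.direct_sum_axioms grading_proj_C2] by simp
  show ?thesis
  proof (intro cochain_complex.intro cochain_complex_axioms.intro A.module_axioms gr)
    show "linear_op A (differential A)"
      unfolding linear_op_def using D by (auto simp: carrier_A A_ops)
    show "differential A v \<in> grade A (p + 1)" if "v \<in> grade A p" for v p
      using that differential_degree grade_closed by (auto simp: grade_A A_ops)
    show "differential A (differential A v) = \<zero>\<^bsub>A\<^esub>" if "v \<in> carrier A" for v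
      using that differential_square by (auto simp: carrier_A A_ops)
  qed
qed

lemma A_dg_algebra: "dg_algebra A"
proof -
  interpret A: cochain_complex A by (rule A_cochain_complex)
  have "monoid A"
  proof (rule monoidI)
    fix x y z assume "x \<in> carrier A" "y \<in> carrier A" "z \<in> carrier A"
    then obtain u v w where uvw: "u \<in> carrier V" "v \<in> carrier V" "w \<in> carrier V"
      "x = cls V u" "y = cls V v" "z = cls V w" unfolding carrier_A by blast
    then show "x \<otimes>\<^bsub>A\<^esub> y \<otimes>\<^bsub>A\<^esub> z = x \<otimes>\<^bsub>A\<^esub> (y \<otimes>\<^bsub>A\<^esub> z)"
      using product_associative_mod_C2[OF uvw(1-3)] by (simp add: A_ops cls_eq_iff)
  qed (auto simp: carrier_A A_ops vacuum_left creation_const)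
  then have "ring A"
    using linear_opD(2)[OF Y_linear] linear_opD(2)[OF mode_linear]
    by (intro ringI A.abelian_group_axioms) (auto simp: carrier_A A_ops)
  then show ?thesis
  proof (intro dg_algebra.intro dg_algebra_axioms.intro A.cochain_complex_axioms)
    show "c \<odot>\<^bsub>A\<^esub> a \<otimes>\<^bsub>A\<^esub> b = c \<odot>\<^bsub>A\<^esub> (a \<otimes>\<^bsub>A\<^esub> b)" if "a \<in> carrier A" "b \<in> carrier A" for a b c
      using that linear_opD(3)[OF Y_linear] by (auto simp: carrier_A A_ops)
    show "a \<otimes>\<^bsub>A\<^esub> (c \<odot>\<^bsub>A\<^esub> b) = c \<odot>\<^bsub>A\<^esub> (a \<otimes>\<^bsub>A\<^esub> b)" if "a \<in> carrier A" "b \<in> carrier A" for a b c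
      using that linear_opD(3)[OF mode_linear] by (auto simp: carrier_A A_ops)
    show "\<one>\<^bsub>A\<^esub> \<in> grade A 0" using vacuum_degree by (simp add: one_A grade_A)
  next
    fix a b p q assume "a \<in> grade A p" "b \<in> grade A q"
    then obtain u v where uv: "u \<in> grade V p" "v \<in> grade V q" "a = cls V u" "b = cls V v"
      unfolding grade_A by blast
    have "nprod V u (-1) v \<in> grade V (p + q)"
      using mode_degree[OF uv(1,2), of "-1"] by (simp add: add.commute)
    then show "a \<otimes>\<^bsub>A\<^esub> b \<in> grade A (p + q)"
      using uv grade_closed by (simp add: A_ops grade_A)
  next
    fix a b p assume "a \<in> grade A p" "b \<in> carrier A"
    then obtain u v where uv: "u \<in> grade V p" "v \<in> carrier V" "a = cls V u" "b = cls V v"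
      unfolding grade_A carrier_A by blast
    then show "differential A (a \<otimes>\<^bsub>A\<^esub> b) =
        differential A a \<otimes>\<^bsub>A\<^esub> b \<oplus>\<^bsub>A\<^esub> sgn_pow p \<odot>\<^bsub>A\<^esub> (a \<otimes>\<^bsub>A\<^esub> differential A b)"
      using grade_closed[OF uv(1)] differential_nprod[OF uv(1,2), of "-1"] by (simp add: A_ops)
  qed
qed

lemma A_dg_poisson_algebra: "dg_poisson_algebra A (-2)"
proof -
  interpret A: dg_algebra A by (rule A_dg_algebra)
  show ?thesis
  proof (intro dg_poisson_algebra.intro dg_poisson_algebra_axioms.intro A.dg_algebra_axioms)
    show "linear_op A (\<lambda>a. bracket A a b)" if "b \<in> carrier A" for b
      using that linear_opD[OF Y_linear] unfolding linear_op_def by (auto simp: carrier_A A_ops)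
    show "linear_op A (bracket A a)" if "a \<in> carrier A" for a
      using that linear_opD[OF mode_linear] unfolding linear_op_def by (auto simp: carrier_A A_ops)
  next
    fix a b p q assume "a \<in> grade A p" "b \<in> grade A q"
    then obtain u v where uv: "u \<in> grade V p" "v \<in> grade V q" "a = cls V u" "b = cls V v"
      unfolding grade_A by blast
    note cl = grade_closed[OF uv(1)] grade_closed[OF uv(2)]
    have "nprod V u 0 v \<in> grade V (p + q + -2)"
      using mode_degree[OF uv(1,2), of 0] by (simp add: algebra_simps)
    then show "bracket A a b \<in> grade A (p + q + -2)"
      using uv cl by (simp add: A_ops grade_A)
    have "bracket A a b \<oplus>\<^bsub>A\<^esub> sgn_pow (p * q) \<odot>\<^bsub>A\<^esub> bracket A b a = \<zero>\<^bsub>A\<^esub>"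
      using bracket_skew_mod_C2[OF uv(1,2)] uv cl
      by (simp add: bracket_A smult_A add_A cls_eq_zero_iff)
    then show "bracket A a b = \<ominus>\<^bsub>A\<^esub> (sgn_pow (p * q) \<odot>\<^bsub>A\<^esub> bracket A b a)"
      using uv cl by (intro A.minus_equality[symmetric]) (auto simp: bracket_A smult_A)
    show "differential A (bracket A a b) =
        bracket A (differential A a) b \<oplus>\<^bsub>A\<^esub> sgn_pow p \<odot>\<^bsub>A\<^esub> bracket A a (differential A b)"
      using uv cl differential_nprod[OF uv(1) cl(2), of 0] by (simp add: A_ops)
  next
    fix a b c p q r assume "a \<in> grade A p" "b \<in> grade A q" "c \<in> grade A r"
    then obtain u v w where uvw: "u \<in> grade V p" "v \<in> grade V q" "w \<in> grade V r"
      "a = cls V u" "b = cls V v" "c = cls V w"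
      unfolding grade_A by blast
    note cl = grade_closed[OF uvw(1)] grade_closed[OF uvw(2)] grade_closed[OF uvw(3)]
    show "bracket A a (bracket A b c) =
        bracket A (bracket A a b) c \<oplus>\<^bsub>A\<^esub> sgn_pow (p * q) \<odot>\<^bsub>A\<^esub> bracket A b (bracket A a c)"
      using uvw cl zero_mode_derivation[OF uvw(1,2) cl(3), of 0] by (simp add: A_ops)
    show "bracket A a (b \<otimes>\<^bsub>A\<^esub> c) =
        bracket A a b \<otimes>\<^bsub>A\<^esub> c \<oplus>\<^bsub>A\<^esub> sgn_pow (p * q) \<odot>\<^bsub>A\<^esub> (b \<otimes>\<^bsub>A\<^esub> bracket A a c)"
      using uvw cl zero_mode_derivation[OF uvw(1,2) cl(3), of "-1"] by (simp add: A_ops)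
  qed simp
qed

lemma A_graded_commutative: "graded_commutative A"
  unfolding graded_commutative_def
proof (intro allI ballI)
  fix a b p q assume "a \<in> grade A p" "b \<in> grade A q"
  then obtain u v where uv: "u \<in> grade V p" "v \<in> grade V q" "a = cls V u" "b = cls V v"
    unfolding grade_A by blast
  then show "a \<otimes>\<^bsub>A\<^esub> b = sgn_pow (p * q) \<odot>\<^bsub>A\<^esub> (b \<otimes>\<^bsub>A\<^esub> a)"
    using grade_closed[OF uv(1)] grade_closed[OF uv(2)] product_commutative_mod_C2[OF uv(1,2)]
    by (simp add: A_ops cls_eq_iff)
qed

end

lemma (in cochain_complex) subcomplexI:
  assumes U: "submodule U complex_field V" and d: "\<And>x. x \<in> U \<Longrightarrow> differential V x \<in> U"
    and proj: "\<And>p x. x \<in> U \<Longrightarrow> grading.proj p x \<in> U"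
  shows "subcomplex U V"
proof -
  let ?N = "V\<lparr>carrier := U, grade := \<lambda>p. U \<inter> grade V p\<rparr>"
  note D = submoduleD[OF U] and dD = linear_opD[OF differential_linear]
  have U': "submodule (carrier ?N) complex_field V" using U by simp
  have N: "zero ?N = zero V" "add ?N = add V" "module.smult ?N = module.smult V" by simp_all
  interpret N: complex_space ?N by (rule restrict_space[OF U' N])
  have "internal_direct_sum ?N UNIV (\<lambda>p. carrier ?N \<inter> grade V p)"
    by (rule grading.restrict_direct_sum[OF U' N]) (use proj in simp)
  then have "internal_direct_sum ?N UNIV (grade ?N)" by simp
  moreover have "linear_op ?N (differential ?N)"
    unfolding linear_op_def using d dD(2,3) D(2) by auto
  ultimately have "cochain_complex ?N"
    by (intro cochain_complex.intro cochain_complex_axioms.intro N.module_axioms)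
      (use d D(2) differential_degree differential_square in auto)
  then show ?thesis using D(1) unfolding subcomplex_def by blast
qed

section \<open>Weights\<close>

context dg_vertex_operator_algebra
begin

sublocale weights: direct_sum V half_integers "weight_space V \<omega>"
  by unfold_locales (rule weight_decomposition)

lemma conformal_in_carrier [simp]: "\<omega> \<in> carrier V"
  using grade_closed[OF conformal_degree] .

lemma mem_weight_space_iff: "v \<in> weight_space V \<omega> n \<longleftrightarrow> v \<in> carrier V \<and> nprod V \<omega> 1 v = of_rat n \<odot> v"
  by (simp add: weight_space_def virasoro_def)

lemma sgn_pow_four [simp]: "sgn_pow (4 * p) = 1"
  by (simp add: power_int_minus_left_even)

text \<open>The commutator of \<open>L(0) = \<omega>\<^sub>1\<close> with \<open>u\<^sub>k\<close> has the two terms \<open>(\<omega>\<^sub>0 u)\<^sub>k\<^sub>+\<^sub>1\<close> and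
  \<open>(\<omega>\<^sub>1 u)\<^sub>k\<close>. The first is \<open>(L(-1) u)\<^sub>k\<^sub>+\<^sub>1 = (u\<^sub>-\<^sub>2 1)\<^sub>k\<^sub>+\<^sub>1 = -(k + 1) u\<^sub>k\<close>.\<close>

lemma weight_operator_mode:
  assumes u: "u \<in> carrier V" and v: "v \<in> carrier V"
  shows "nprod V \<omega> 1 (nprod V u k v) =
    nprod V u k (nprod V \<omega> 1 v) \<oplus> (nprod V (nprod V \<omega> 1 u) k v \<oplus> of_int (- 1 - k) \<odot> nprod V u k v)"
proof (rule grading.linear_op_eqI[OF _ _ _ u])
  show "linear_op V (\<lambda>u. nprod V \<omega> 1 (nprod V u k v))"
    by (intro linear_modes Y_linear v conformal_in_carrier)
  show "linear_op V (\<lambda>u. nprod V u k (nprod V \<omega> 1 v) \<oplus>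
      (nprod V (nprod V \<omega> 1 u) k v \<oplus> of_int (- 1 - k) \<odot> nprod V u k v))"
    by (intro linear_op_add linear_op_smult linear_modes mode_linear Y_linear v nprod_closed conformal_in_carrier)
next
  fix p u assume u: "u \<in> grade V p"
  note cl = grade_closed[OF u] v
  let ?f = "\<lambda>i. (of_int 1 gchoose i) \<odot> nprod V (nprod V \<omega> (int i) u) (1 + k - int i) v"
  have "finsupp_sum V (UNIV :: nat set) ?f = finsum V ?f {0, 1}"
  proof (rule finsupp_sum_eq_finsum)
    fix i :: nat assume "i \<in> UNIV - {0, 1}"
    then have "(of_int 1 :: complex) gchoose i = 0"
      by (simp add: binomial_gbinomial[of 1 i, symmetric, simplified] binomial_eq_0)
    then show "?f i = \<zero>" using cl by simp
  qed (use cl in auto)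
  also have "\<dots> = ?f 0 \<oplus> ?f 1"
    using cl by (simp add: finsum_insert Pi_def)
  also have "?f 0 = of_int (- 1 - k) \<odot> nprod V u k v"
  proof -
    have "nprod V \<omega> 0 u = nprod V u (-2) (vacuum V)"
      using translation[OF cl(1)] by (simp add: virasoro_def)
    then show ?thesis using cl translate_mode[OF cl, of "1 + k"] by simp
  qed
  also have "?f 1 = nprod V (nprod V \<omega> 1 u) k v" using cl by simp
  finally have "nprod V \<omega> 1 (nprod V u k v) \<ominus> nprod V u k (nprod V \<omega> 1 v) =
      of_int (- 1 - k) \<odot> nprod V u k v \<oplus> nprod V (nprod V \<omega> 1 u) k v"
    using commutator_formula[OF conformal_degree u v, of 1 k] cl by simp
  then show "nprod V \<omega> 1 (nprod V u k v) =
      nprod V u k (nprod V \<omega> 1 v) \<oplus> (nprod V (nprod V \<omega> 1 u) k v \<oplus> of_int (- 1 - k) \<odot> nprod V u k v)"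
    using cl by (subst (asm) minus_eq_iff) (auto simp: a_ac)
qed

lemma mode_weight:
  assumes u: "u \<in> weight_space V \<omega> m" and v: "v \<in> weight_space V \<omega> n"
  shows "nprod V u k v \<in> weight_space V \<omega> (m + n - of_int k - 1)"
proof -
  have cl: "u \<in> carrier V" "v \<in> carrier V"
    and L: "nprod V \<omega> 1 u = of_rat m \<odot> u" "nprod V \<omega> 1 v = of_rat n \<odot> v"
    using u v by (auto simp: mem_weight_space_iff)
  have "nprod V \<omega> 1 (nprod V u k v) = of_rat n \<odot> nprod V u k v \<oplus>
      (of_rat m \<odot> nprod V u k v \<oplus> of_int (- 1 - k) \<odot> nprod V u k v)"
    using weight_operator_mode[OF cl, of k] cl linear_opD(3)[OF mode_linear] linear_opD(3)[OF Y_linear]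
    by (simp add: L)
  also have "\<dots> = (of_rat n + (of_rat m + of_int (- 1 - k))) \<odot> nprod V u k v"
    using cl by (simp only: smult_add_left nprod_closed)
  also have "of_rat n + (of_rat m + of_int (- 1 - k)) = (of_rat (m + n - of_int k - 1) :: complex)"
    by (simp add: of_rat_add of_rat_diff)
  finally show ?thesis using cl by (simp add: mem_weight_space_iff)
qed

lemma half_integers_weight:
  assumes "m \<in> half_integers" "n \<in> half_integers"
  shows "m + n - of_int k - 1 \<in> half_integers"
proof -
  have "2 * (m + n - of_int k - 1) = 2 * m + 2 * n - of_int (2 * k + 2)" by (simp add: algebra_simps)
  then show ?thesis using assms unfolding half_integers_def mem_Collect_eq by (metis Ints_add Ints_diff Ints_of_int)
qed

text \<open>\<open>L(0)\<close> commutes with the differential, since \<open>\<omega>\<close> is closed of even degree.\<close>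

lemma differential_weight:
  assumes "v \<in> weight_space V \<omega> n"
  shows "differential V v \<in> weight_space V \<omega> n"
proof -
  have v: "v \<in> carrier V" "nprod V \<omega> 1 v = of_rat n \<odot> v" using assms by (auto simp: mem_weight_space_iff)
  have "sgn_pow 4 = 1" using sgn_pow_four[of 1] by simp
  then have "differential V (nprod V \<omega> 1 v) = nprod V \<omega> 1 (differential V v)"
    using differential_nprod[OF conformal_degree v(1), of 1] v conformal_closed by simp
  then show ?thesis
    using v linear_opD(3)[OF differential_linear] by (simp add: mem_weight_space_iff)
qed

text \<open>\<open>\<omega>\<^sub>1\<close> has degree \<open>4 - 2 - 2 = 0\<close>, so it commutes with the degree projections.\<close>

lemma grading_proj_weight:
  assumes v: "v \<in> weight_space V \<omega> n"
  shows "grading.proj p v \<in> weight_space V \<omega> n"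
proof -
  have vV: "v \<in> carrier V" and L: "nprod V \<omega> 1 v = of_rat n \<odot> v"
    using v by (auto simp: mem_weight_space_iff)
  have pl: "linear_op V (grading.proj p)" by (rule grading.component_linear) simp
  have "nprod V \<omega> 1 (grading.proj p v) = grading.proj p (nprod V \<omega> 1 v)"
  proof (rule grading.component_commute[symmetric, OF mode_linear])
    show "nprod V \<omega> 1 x \<in> grade V q" if "x \<in> grade V q" for q x
      using mode_degree[OF conformal_degree that, of 1] by simp
  qed (use vV in auto)
  then show ?thesis
    using linear_opD(1,3)[OF pl vV] by (simp add: L mem_weight_space_iff)
qed

lemma weights_proj_C2:
  assumes "n \<in> half_integers" "x \<in> C2 V"
  shows "weights.proj n x \<in> C2 V"
proof (rule proj_C2[OF weights.direct_sum_axioms _ assms])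
  fix i j u v
  assume "i \<in> half_integers" "j \<in> half_integers" "u \<in> weight_space V \<omega> i" "v \<in> weight_space V \<omega> j"
  then show "\<exists>k\<in>half_integers. nprod V u (-2) v \<in> weight_space V \<omega> k"
    using mode_weight half_integers_weight by blast
qed

abbreviation bigrading where "bigrading \<equiv> \<lambda>(p, n). weight_space V \<omega> n \<inter> grade V p"

sublocale bigrading: direct_sum V "UNIV \<times> half_integers" bigrading
  by unfold_locales
    (rule direct_sum_refine[OF grading.direct_sum_axioms weights.direct_sum_axioms grading_proj_weight])

lemma bigrading_proj_C2:
  assumes "k \<in> UNIV \<times> half_integers" "x \<in> C2 V"
  shows "bigrading.proj k x \<in> C2 V"
proof (rule proj_C2[OF bigrading.direct_sum_axioms _ assms])
  fix i j u v
  assume ij: "i \<in> UNIV \<times> half_integers" "j \<in> UNIV \<times> half_integers" "u \<in> bigrading i" "v \<in> bigrading j"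
  then obtain p m q n where i: "i = (p, m)" "j = (q, n)" "m \<in> half_integers" "n \<in> half_integers" by blast
  then have uv: "u \<in> weight_space V \<omega> m" "u \<in> grade V p" "v \<in> weight_space V \<omega> n" "v \<in> grade V q"
    using ij by auto
  let ?k = "(q + (p - 2 * -2 - 2), m + n - of_int (-2) - 1)"
  have "nprod V u (-2) v \<in> bigrading ?k"
    using mode_degree[OF uv(2,4), of "-2"] mode_weight[OF uv(1,3), of "-2"] by simp
  moreover have "?k \<in> UNIV \<times> half_integers" using half_integers_weight[OF i(3,4), of "-2"] by simp
  ultimately show "\<exists>k\<in>UNIV \<times> half_integers. nprod V u (-2) v \<in> bigrading k" by blast
qed

lemma A_bigraded:
  "internal_direct_sum A (UNIV \<times> half_integers) (\<lambda>(p, n). cls V ` (weight_space V \<omega> n \<inter> grade V p))"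
proof -
  have "(\<lambda>(p, n). cls V ` (weight_space V \<omega> n \<inter> grade V p)) = (\<lambda>k. cls V ` bigrading k)" by auto
  then show ?thesis
    using image_direct_sum_A(1)[OF bigrading.direct_sum_axioms bigrading_proj_C2] by simp
qed

lemma A_weight_subcomplex:
  assumes n: "n \<in> half_integers"
  shows "subcomplex (cls V ` weight_space V \<omega> n) A"
proof -
  interpret A: cochain_complex A by (rule A_cochain_complex)
  have wA: "internal_direct_sum A half_integers (\<lambda>n. cls V ` weight_space V \<omega> n)"
    by (rule image_direct_sum_A(1)[OF weights.direct_sum_axioms weights_proj_C2])
  have gr: "grade A = (\<lambda>p. cls V ` grade V p)" by (rule ext) (rule grade_A)
  show ?thesis
  proof (rule A.subcomplexI)
    show "submodule (cls V ` weight_space V \<omega> n) complex_field A"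
      using wA n unfolding internal_direct_sum_def by blast
  next
    fix x assume "x \<in> cls V ` weight_space V \<omega> n"
    then obtain v where v: "v \<in> weight_space V \<omega> n" "x = cls V v" by blast
    have vV: "v \<in> carrier V" using v by (simp add: mem_weight_space_iff)
    show "differential A x \<in> cls V ` weight_space V \<omega> n"
      unfolding v(2) differential_A[OF vV] by (rule imageI) (rule differential_weight[OF v(1)])
    fix p
    have "A.grading.proj p x = cls V (grading.proj p v)"
      unfolding v(2) gr
      by (rule image_direct_sum_A(2)[OF grading.direct_sum_axioms grading_proj_C2 UNIV_I vV])
    then show "A.grading.proj p x \<in> cls V ` weight_space V \<omega> n"
      using grading_proj_weight[OF v(1)] by simp
  qed
qed

lemma A_weight_graded: "weight_graded_dg_poisson_algebra A (-2) (\<lambda>n. cls V ` weight_space V \<omega> n)"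
proof (intro weight_graded_dg_poisson_algebra.intro weight_graded_dg_poisson_algebra_axioms.intro
    A_dg_poisson_algebra A_weight_subcomplex)
  show "internal_direct_sum A half_integers (\<lambda>n. cls V ` weight_space V \<omega> n)"
    by (rule image_direct_sum_A(1)[OF weights.direct_sum_axioms weights_proj_C2])
next
  fix m n a b assume "a \<in> cls V ` weight_space V \<omega> m" "b \<in> cls V ` weight_space V \<omega> n"
  then obtain u v where uv: "u \<in> weight_space V \<omega> m" "v \<in> weight_space V \<omega> n" "a = cls V u" "b = cls V v"
    by blast
  then have cl: "u \<in> carrier V" "v \<in> carrier V" by (auto simp: mem_weight_space_iff)
  show "a \<otimes>\<^bsub>A\<^esub> b \<in> cls V ` weight_space V \<omega> (m + n)"
    using mode_weight[OF uv(1,2), of "-1"] uv(3,4) cl by (simp add: mult_A)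
  show "bracket A a b \<in> cls V ` weight_space V \<omega> (m + n - 1)"
    using mode_weight[OF uv(1,2), of 0] uv(3,4) cl by (simp add: bracket_A)
qed

text \<open>If \<open>u\<close> of weight \<open>n\<close> and \<open>v\<close> of degree \<open>p\<close> have the same class, the degree \<open>p\<close> component
  of \<open>u\<close> represents it as well: it differs from \<open>v\<close> by the degree \<open>p\<close> component of
  \<open>u - v\<close>, which lies in \<open>C\<^sub>2(V)\<close>.\<close>

lemma A_weight_inter_grade:
  "cls V ` weight_space V \<omega> n \<inter> grade A p = cls V ` (weight_space V \<omega> n \<inter> grade V p)"
proof
  show "cls V ` (weight_space V \<omega> n \<inter> grade V p) \<subseteq> cls V ` weight_space V \<omega> n \<inter> grade A p"
    unfolding grade_A by blast
  show "cls V ` weight_space V \<omega> n \<inter> grade A p \<subseteq> cls V ` (weight_space V \<omega> n \<inter> grade V p)"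
  proof
    fix x assume "x \<in> cls V ` weight_space V \<omega> n \<inter> grade A p"
    then obtain u v where u: "u \<in> weight_space V \<omega> n" "x = cls V u" and v: "v \<in> grade V p" "x = cls V v"
      unfolding grade_A by blast
    have cl: "u \<in> carrier V" "v \<in> carrier V"
      using u v grade_closed by (auto simp: mem_weight_space_iff)
    have pl: "linear_op V (grading.proj p)" by (rule grading.component_linear) simp
    have "u \<ominus> v \<in> C2 V" using cls_eq_iff[OF cl] u(2) v(2) by simp
    then have "grading.proj p (u \<ominus> v) \<in> C2 V" by (rule grading_proj_C2)
    moreover have "grading.proj p v = v" using grading.component_of_mem[OF v(1)] by simp
    ultimately have "cls V (grading.proj p u) = x"
      using linear_opD(1,5)[OF pl] cl v by (simp add: cls_eq_iff)
    moreover have "grading.proj p u \<in> weight_space V \<omega> n \<inter> grade V p"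
      using grading_proj_weight[OF u(1)] grading.component_in[OF cl(1)] by simp
    ultimately show "x \<in> cls V ` (weight_space V \<omega> n \<inter> grade V p)" by blast
  qed
qed

end

theorem theorem5p1:
  fixes V :: "('a, 'm) dg_va_scheme"
  assumes "dg_vertex_algebra V"
  shows "(dg_poisson_algebra (R_alg V) (-2) \<and>
      graded_commutative (R_alg V) \<and>
      (\<forall>u\<in>carrier V. \<forall>v\<in>carrier V. cls V u \<otimes>\<^bsub>R_alg V\<^esub> cls V v = cls V (nprod V u (-1) v)) \<and>
      (\<forall>u\<in>carrier V. \<forall>v\<in>carrier V. bracket (R_alg V) (cls V u) (cls V v) = cls V (nprod V u 0 v)) \<and>
      (\<forall>u\<in>carrier V. differential (R_alg V) (cls V u) = cls V (differential V u)) \<and>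
      (\<forall>c. \<forall>u\<in>carrier V. c \<odot>\<^bsub>R_alg V\<^esub> cls V u = cls V (c \<odot>\<^bsub>V\<^esub> u))) \<and>
    (\<forall>\<omega>. dg_vertex_operator_algebra V \<omega> \<longrightarrow>
      weight_graded_dg_poisson_algebra (R_alg V) (-2) (\<lambda>n. cls V ` weight_space V \<omega> n) \<and>
      internal_direct_sum (R_alg V) (UNIV \<times> half_integers)
        (\<lambda>(p, n). cls V ` (weight_space V \<omega> n \<inter> grade V p)) \<and>
      (\<forall>p. \<forall>n\<in>half_integers. cls V ` weight_space V \<omega> n \<inter> grade (R_alg V) p =
        cls V ` (weight_space V \<omega> n \<inter> grade V p)))"
proof -
  interpret dg_vertex_algebra V by (rule assms)
  show ?thesis
    using A_dg_poisson_algebra A_graded_commutative mult_A bracket_A differential_A smult_A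
      dg_vertex_operator_algebra.A_weight_graded dg_vertex_operator_algebra.A_bigraded
      dg_vertex_operator_algebra.A_weight_inter_grade
    by (intro conjI allI impI ballI)
qed

end
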